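(* Let $u,\psi\in\mathcal{H}(\mathbb{C})$ be such that $\psi$ is not a constant, let $1\leq p\leq\infty$, $n\in\{0,1,2,\dots\}$, and let $D_{(u,\psi,n)}$ be bounded on $\mathcal{F}_p$. Then $D_{(u,\psi,n)}$ has closed range (as an operator on $\mathcal{F}_p$) if and only if there exists $\epsilon_n>0$ such that $G_{(u,\psi,n)}^{\epsilon_n}$ is a $(p,n)$ sampling set for $\mathcal{F}_{(p,n)}^0$, where $$\mathcal{F}_{(p,n)}^0=\{f\in\mathcal{F}_p:\ f(0)=f'(0)=\dots=f^{(n-1)}(0)=0\}.$$
   Context: $\mathcal{H}(\mathbb{C})$ denotes the set of entire functions on $\mathbb{C}$ and $A$ is the Lebesgue area measure. The Fock space is $\mathcal{F}_p=\{f\in\mathcal{H}(\mathbb{C}):\|f\|_p<\infty\}$, where $\|f\|_p=\big(\frac{p}{2\pi}\int_{\mathbb{C}}|f(z)|^pe^{-\frac p2|z|^2}dA(z)\big)^{1/p}$ for $1\leq p<\infty$ and $\|f\|_\infty=\sup_{z\in\mathbb{C}}|f(z)|e^{-\frac12|z|^2}$. For $n=0$, $\mathcal{F}_{(p,0)}^0=\mathcal{F}_p$. For $u,\psi\in\mathcal{H}(\mathbb{C})$ and $n\in\{0,1,2,\dots\}$, the weighted composition–differentiation operator is $D_{(u,\psi,n)}f=u\cdot(f^{(n)}\circ\psi)$, where $f^{(n)}$ is the $n$-th derivative and $f^{(0)}=f$, and $$L_{(u,\psi,n)}(z)=|u(z)|\,|\psi(z)|^n\,e^{\frac12(|\psi(z)|^2-|z|^2)},\qquad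 z\in\mathbb{C}.$$ For $\epsilon>0$ set $$\Omega_{(u,\psi,n)}^{\epsilon}=\{z\in\mathbb{C}:L_{(u,\psi,n)}(z)>\epsilon\},\qquad G_{(u,\psi,n)}^{\epsilon}=\psi\big(\Omega_{(u,\psi,n)}^{\epsilon}\big).$$ Sampling sets: let $1\leq p\leq\infty$, $k\in\{0,1,2,\dots\}$ and let $M$ be a non-empty subset of $\mathcal{F}_p$. A subset $S$ of $\mathbb{C}$ is a $(p,k)$ sampling set for $M$ if there exists a constant $\delta_k>0$ such that for all $f\in M$, $$\delta_k\|f\|_p\leq\Big(\int_S\frac{|f^{(k)}(z)|^p}{(1+|z|)^{kp}}e^{-\frac p2|z|^2}dA(z)\Big)^{1/p}\ \text{ if }p<\infty,\qquad \delta_k\|f\|_\infty\leq\sup_{z\in S}\frac{|f^{(k)}(z)|}{(1+|z|)^k}e^{-\frac{|z|^2}{2}}\ \text{ if }p=\infty.$$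
   Formalization: It is additionally assumed that u is not identically zero; for u = 0 the operator is 0 with closed range {0}, but every G^ε is empty and cannot be a sampling set (take f(z) = z^n), so the equivalence fails. *)

theory Defs
  imports "HOL-Analysis.Analysis"
begin

text \<open>The real power of an extended nonnegative number, for a positive exponent.\<close>

definition epowr :: "ennreal \<Rightarrow> real \<Rightarrow> ennreal" where
  "epowr x r = (if x = \<infinity> then \<infinity> else ennreal (enn2real x powr r))"

text \<open>
  The exponent \<open>p\<close> ranges over \<open>[1, \<infinity>]\<close> and is an \<open>ennreal\<close>; norms are first defined on all
  functions with values in \<open>[0, \<infinity>]\<close>.
\<close>

definition fock_enorm :: "ennreal \<Rightarrow> (complex \<Rightarrow> complex) \<Rightarrow> ennreal" where
  "fock_enorm p f =
     (if p = \<infinity>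
      then (SUP z. ennreal (norm (f z) * exp (- (1/2) * (norm z)\<^sup>2)))
      else (let q = enn2real p in
        epowr (ennreal (q / (2 * pi)) *
          (\<integral>\<^sup>+ z. ennreal (norm (f z) powr q * exp (- (q/2) * (norm z)\<^sup>2)) \<partial>lebesgue)) (1 / q)))"

definition fock_space :: "ennreal \<Rightarrow> (complex \<Rightarrow> complex) set" where
  "fock_space p = {f. f holomorphic_on UNIV \<and> fock_enorm p f < \<infinity>}"

definition fock_norm :: "ennreal \<Rightarrow> (complex \<Rightarrow> complex) \<Rightarrow> real" where
  "fock_norm p f = enn2real (fock_enorm p f)"

definition fock_dist :: "ennreal \<Rightarrow> (complex \<Rightarrow> complex) \<Rightarrow> (complex \<Rightarrow> complex) \<Rightarrow> real" where
  "fock_dist p f g = fock_norm p (\<lambda>z. f z - g z)"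

lemma fock_integrand_measurable:
  assumes "f holomorphic_on UNIV"
  shows "(\<lambda>z. ennreal (norm (f z) powr q * exp (- (q/2) * (norm z)\<^sup>2))) \<in> borel_measurable borel"
proof -
  have "f \<in> borel_measurable borel"
    using assms borel_measurable_continuous_onI holomorphic_on_imp_continuous_on by blast
  then show ?thesis by measurable
qed

lemma fock_enorm_uminus: "fock_enorm p (\<lambda>z. - f z) = fock_enorm p f"
  by (simp add: fock_enorm_def)

lemma fock_enorm_zero: "fock_enorm p (\<lambda>z. 0) = 0"
  by (simp add: fock_enorm_def Let_def epowr_def)

lemma fock_enorm_eq_0D:
  assumes "f holomorphic_on UNIV" "1 \<le> p" "fock_enorm p f = 0"
  shows "f = (\<lambda>z. 0)"
proof (cases "p = \<infinity>")
  case True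
  have "ennreal (norm (f z) * exp (- (1/2) * (norm z)\<^sup>2)) \<le> 0" for z
    using assms(3) True unfolding fock_enorm_def by (metis (lifting) SUP_upper UNIV_I)
  then show ?thesis by (auto simp: fun_eq_iff ennreal_eq_0_iff mult_le_0_iff)
next
  case False
  define q where "q = enn2real p"
  have q: "q \<ge> 1"
    using assms(2) False unfolding q_def by (cases p) (auto simp: ennreal_le_iff2 simp flip: ennreal_1)
  let ?I = "\<lambda>z. ennreal (norm (f z) powr q * exp (- (q/2) * (norm z)\<^sup>2))"
  have "ennreal (q / (2 * pi)) * (\<integral>\<^sup>+ z. ?I z \<partial>lborel) = 0"
    using assms(3) False q
    by (auto simp: fock_enorm_def q_def[symmetric] Let_def epowr_def nn_integral_completion
        enn2real_eq_0_iff ennreal_eq_0_iff powr_def split: if_splits)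
  then have "(\<integral>\<^sup>+ z. ?I z \<partial>lborel) = 0"
    using q by (auto simp: ennreal_eq_0_iff divide_le_0_iff mult_le_0_iff simp flip: not_less)
  then have "emeasure lborel {z. ?I z \<noteq> 0} = 0"
    using fock_integrand_measurable[OF assms(1)] by (subst (asm) nn_integral_0_iff) auto
  moreover have eq: "{z. ?I z \<noteq> 0} = {z. f z \<noteq> 0}"
    using q by (auto simp: ennreal_eq_0_iff mult_le_0_iff not_le)
  moreover have op: "open {z. f z \<noteq> 0}"
    using assms(1) by (intro open_Collect_neq) (auto intro: holomorphic_on_imp_continuous_on)
  ultimately have "negligible {z. f z \<noteq> 0}"
    by (simp add: negligible_iff_null_sets null_sets_def)
  then have "{z. f z \<noteq> 0} = {}"
    using op open_not_negligible by blast
  then show ?thesis by auto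
qed

lemma powr_convex_sum:
  assumes "q \<ge> 1" "x \<ge> 0" "y \<ge> 0" "s > 0" "t > 0" "s + t = (1::real)"
  shows "(s * x + t * y) powr q \<le> s * x powr q + t * y powr q"
proof -
  have *: "s powr q \<le> s" "t powr q \<le> t"
    using assms powr_mono'[of 1 q s] powr_mono'[of 1 q t] by auto
  consider "x = 0" | "y = 0" | "x > 0" "y > 0" using assms by linarith
  then show ?thesis
  proof cases
    case 3
    moreover have "s = 1 - t" using assms by simp
    ultimately show ?thesis
      using convex_onD[OF powr_convex[OF assms(1)], of t x y] assms(4,5) by simp
  qed (use assms * in \<open>auto simp: powr_mult intro!: mult_right_mono\<close>)
qed

lemma fock_enorm_triangle:
  assumes f: "f holomorphic_on UNIV" and g: "g holomorphic_on UNIV" and p: "1 \<le> p"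
  shows "fock_enorm p (\<lambda>z. f z + g z) \<le> fock_enorm p f + fock_enorm p g"
proof (cases "p = \<infinity>")
  case True
  have "ennreal (norm (f z + g z) * exp (- (1/2) * (norm z)\<^sup>2)) \<le> fock_enorm p f + fock_enorm p g" for z
  proof -
    have "ennreal (norm (f z + g z) * exp (- (1/2) * (norm z)\<^sup>2)) \<le>
        ennreal (norm (f z) * exp (- (1/2) * (norm z)\<^sup>2)) + ennreal (norm (g z) * exp (- (1/2) * (norm z)\<^sup>2))"
      by (simp flip: ennreal_plus distrib_right add: norm_triangle_ineq ennreal_leI)
    also have "\<dots> \<le> fock_enorm p f + fock_enorm p g"
      unfolding fock_enorm_def using True by (simp only: simp_thms if_True) (intro add_mono SUP_upper; simp)
    finally show ?thesis .
  qed
  then show ?thesis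
    using True unfolding fock_enorm_def[of p "\<lambda>z. f z + g z"] by (auto intro: SUP_least)
next
  case False
  define q where "q = enn2real p"
  have q: "q \<ge> 1"
    using p False unfolding q_def by (cases p) (auto simp: ennreal_le_iff2 simp flip: ennreal_1)
  let ?I = "\<lambda>h z. ennreal (norm (h z) powr q * exp (- (q/2) * (norm z)\<^sup>2))"
  define J where "J h = ennreal (q / (2 * pi)) * (\<integral>\<^sup>+ z. ?I h z \<partial>lborel)" for h :: "complex \<Rightarrow> complex"
  have N: "fock_enorm p h = epowr (J h) (1 / q)" for h
    using False by (simp add: fock_enorm_def q_def J_def Let_def nn_integral_completion)
  consider "fock_enorm p f = \<infinity> \<or> fock_enorm p g = \<infinity>" | "fock_enorm p f = 0" | "fock_enorm p g = 0"
    | a b where "a > 0" "b > 0" "fock_enorm p f = ennreal a" "fock_enorm p g = ennreal b"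
    by (cases "fock_enorm p f"; cases "fock_enorm p g") (auto simp: order.order_iff_strict)
  then show ?thesis
  proof cases
    case 2
    then show ?thesis using fock_enorm_eq_0D[OF f p] by simp
  next
    case 3
    then show ?thesis using fock_enorm_eq_0D[OF g p] by simp
  next
    case 4
    have J: "J h = ennreal (c powr q)" if "c > 0" "fock_enorm p h = ennreal c" for h c
      using that q unfolding N epowr_def
      by (cases "J h") (auto split: if_splits simp: powr_powr ennreal_inj)
    define s t where "s = a / (a + b)" and "t = b / (a + b)"
    have st: "s > 0" "t > 0" "s + t = 1" using 4 by (auto simp: s_def t_def simp flip: add_divide_distrib)
    define A B where "A = (a + b) powr q * (s * a powr - q)" and "B = (a + b) powr q * (t * b powr - q)"
    have AB: "A \<ge> 0" "B \<ge> 0" using st by (auto simp: A_def B_def)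
    have "?I (\<lambda>z. f z + g z) z \<le> ennreal A * ?I f z + ennreal B * ?I g z" for z
    proof -
      have "norm (f z + g z) \<le> (a + b) * (s * (norm (f z) / a) + t * (norm (g z) / b))"
        using 4 norm_triangle_ineq[of "f z" "g z"] by (simp add: s_def t_def distrib_left)
      then have "norm (f z + g z) powr q \<le> ((a + b) * (s * (norm (f z) / a) + t * (norm (g z) / b))) powr q"
        using q by (intro powr_mono2) auto
      also have "\<dots> = (a + b) powr q * (s * (norm (f z) / a) + t * (norm (g z) / b)) powr q"
        using 4 st by (intro powr_mult) 
      also have "\<dots> \<le> (a + b) powr q * (s * (norm (f z) / a) powr q + t * (norm (g z) / b) powr q)"
        using 4 st q by (intro mult_left_mono powr_convex_sum) auto
      also have "\<dots> = A * norm (f z) powr q + B * norm (g z) powr q"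
        using 4 by (simp add: A_def B_def powr_divide powr_minus field_simps)
      finally have "norm (f z + g z) powr q * exp (- (q/2) * (norm z)\<^sup>2) \<le>
          (A * norm (f z) powr q + B * norm (g z) powr q) * exp (- (q/2) * (norm z)\<^sup>2)"
        by (intro mult_right_mono) auto
      then show ?thesis
        using AB by (simp flip: ennreal_mult ennreal_plus add: ennreal_leI algebra_simps)
    qed
    then have "(\<integral>\<^sup>+ z. ?I (\<lambda>z. f z + g z) z \<partial>lborel) \<le>
        (\<integral>\<^sup>+ z. ennreal A * ?I f z + ennreal B * ?I g z \<partial>lborel)"
      by (intro nn_integral_mono)
    also have "\<dots> = ennreal A * (\<integral>\<^sup>+ z. ?I f z \<partial>lborel) + ennreal B * (\<integral>\<^sup>+ z. ?I g z \<partial>lborel)"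
      using fock_integrand_measurable[OF f, of q] fock_integrand_measurable[OF g, of q]
      by (simp add: nn_integral_add nn_integral_cmult)
    finally have "J (\<lambda>z. f z + g z) \<le> ennreal A * J f + ennreal B * J g"
      unfolding J_def by (metis (no_types, lifting) distrib_left mult.left_commute mult_left_mono zero_le)
    also have "\<dots> = ennreal (A * a powr q + B * b powr q)"
      using 4 AB by (simp add: J flip: ennreal_mult ennreal_plus)
    also have "A * a powr q + B * b powr q = (a + b) powr q * (s + t)"
      using 4 by (simp add: A_def B_def powr_minus field_simps)
    finally have *: "J (\<lambda>z. f z + g z) \<le> ennreal ((a + b) powr q)" using st by simp
    then obtain r where r: "J (\<lambda>z. f z + g z) = ennreal r" "r \<ge> 0" "r \<le> (a + b) powr q"
      by (cases "J (\<lambda>z. f z + g z)") (auto simp: top_unique)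
    have "r powr (1 / q) \<le> ((a + b) powr q) powr (1 / q)"
      using r q by (intro powr_mono2) auto
    then have "r powr (1 / q) \<le> a + b" using q 4 by (simp add: powr_powr)
    then show ?thesis
      using 4 r by (simp add: N[of "\<lambda>z. f z + g z"] epowr_def ennreal_leI flip: ennreal_plus)
  qed auto
qed

lemma Metric_space_fock:
  assumes p: "1 \<le> p"
  shows "Metric_space (fock_space p) (fock_dist p)"
proof
  fix f g h
  show "0 \<le> fock_dist p f g" by (simp add: fock_dist_def fock_norm_def)
  show "fock_dist p f g = fock_dist p g f"
    using fock_enorm_uminus[of p "\<lambda>z. f z - g z"] by (simp add: fock_dist_def fock_norm_def)
  have fin: "fock_enorm p (\<lambda>z. f z - g z) < \<infinity>" if "f \<in> fock_space p" "g \<in> fock_space p" for f g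
  proof -
    have "fock_enorm p (\<lambda>z. f z + - g z) \<le> fock_enorm p f + fock_enorm p (\<lambda>z. - g z)"
      using that by (intro fock_enorm_triangle p holomorphic_intros) (auto simp: fock_space_def)
    then show ?thesis
      using that by (auto simp: fock_space_def fock_enorm_uminus intro: le_less_trans)
  qed
  show "fock_dist p f g = 0 \<longleftrightarrow> f = g" if fg: "f \<in> fock_space p" "g \<in> fock_space p"
  proof
    assume "fock_dist p f g = 0"
    then have "fock_enorm p (\<lambda>z. f z - g z) = 0"
      using fin[OF fg] by (auto simp: fock_dist_def fock_norm_def enn2real_eq_0_iff)
    moreover have "(\<lambda>z. f z - g z) holomorphic_on UNIV"
      using fg by (auto simp: fock_space_def intro!: holomorphic_intros)
    ultimately have "(\<lambda>z. f z - g z) = (\<lambda>z. 0)" using fock_enorm_eq_0D p by blast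
    then show "f = g" by (simp add: fun_eq_iff)
  qed (simp add: fock_dist_def fock_norm_def fock_enorm_zero)
  show "fock_dist p f h \<le> fock_dist p f g + fock_dist p g h"
    if m: "f \<in> fock_space p" "g \<in> fock_space p" "h \<in> fock_space p"
  proof -
    have "fock_enorm p (\<lambda>z. (f z - g z) + (g z - h z)) \<le>
        fock_enorm p (\<lambda>z. f z - g z) + fock_enorm p (\<lambda>z. g z - h z)"
      using m by (intro fock_enorm_triangle p holomorphic_intros) (auto simp: fock_space_def)
    then have "enn2real (fock_enorm p (\<lambda>z. f z - h z)) \<le>
        enn2real (fock_enorm p (\<lambda>z. f z - g z) + fock_enorm p (\<lambda>z. g z - h z))"
      using fin m by (intro enn2real_mono) auto
    then show ?thesis
      using fin m by (simp add: fock_dist_def fock_norm_def enn2real_plus)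
  qed
qed

text \<open>
  For \<open>1 \<le> p\<close> the next definition is the norm topology of the Fock space, by \<open>Metric_space_fock\<close>.
\<close>

definition fock_topology :: "ennreal \<Rightarrow> (complex \<Rightarrow> complex) topology" where
  "fock_topology p = Metric_space.mtopology (fock_space p) (fock_dist p)"

definition fock_space0 :: "ennreal \<Rightarrow> nat \<Rightarrow> (complex \<Rightarrow> complex) set" where
  "fock_space0 p n = {f \<in> fock_space p. \<forall>j<n. (deriv ^^ j) f 0 = 0}"

definition wcd_op ::
  "(complex \<Rightarrow> complex) \<Rightarrow> (complex \<Rightarrow> complex) \<Rightarrow> nat \<Rightarrow> (complex \<Rightarrow> complex) \<Rightarrow> complex \<Rightarrow> complex" where
  "wcd_op u \<psi> n f = (\<lambda>z. u z * (deriv ^^ n) f (\<psi> z))"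

definition bounded_on_fock ::
  "ennreal \<Rightarrow> ((complex \<Rightarrow> complex) \<Rightarrow> complex \<Rightarrow> complex) \<Rightarrow> bool" where
  "bounded_on_fock p T \<longleftrightarrow>
     (\<forall>f\<in>fock_space p. T f \<in> fock_space p) \<and>
     (\<exists>C. \<forall>f\<in>fock_space p. fock_norm p (T f) \<le> C * fock_norm p f)"

definition closed_range_on_fock ::
  "ennreal \<Rightarrow> ((complex \<Rightarrow> complex) \<Rightarrow> complex \<Rightarrow> complex) \<Rightarrow> bool" where
  "closed_range_on_fock p T \<longleftrightarrow> closedin (fock_topology p) (T ` fock_space p)"

definition L_fun ::
  "(complex \<Rightarrow> complex) \<Rightarrow> (complex \<Rightarrow> complex) \<Rightarrow> nat \<Rightarrow> complex \<Rightarrow> real" where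
  "L_fun u \<psi> n z =
     norm (u z) * norm (\<psi> z) ^ n * exp (1/2 * ((norm (\<psi> z))\<^sup>2 - (norm z)\<^sup>2))"

definition Omega_set ::
  "(complex \<Rightarrow> complex) \<Rightarrow> (complex \<Rightarrow> complex) \<Rightarrow> nat \<Rightarrow> real \<Rightarrow> complex set" where
  "Omega_set u \<psi> n \<epsilon> = {z. L_fun u \<psi> n z > \<epsilon>}"

definition G_set ::
  "(complex \<Rightarrow> complex) \<Rightarrow> (complex \<Rightarrow> complex) \<Rightarrow> nat \<Rightarrow> real \<Rightarrow> complex set" where
  "G_set u \<psi> n \<epsilon> = \<psi> ` Omega_set u \<psi> n \<epsilon>"

text \<open>
  Both sides of the sampling inequality live in \<open>[0, \<infinity>]\<close>, so that an infinite integral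
  or supremum on the right is read as making it true, and the supremum over the empty set is \<open>0\<close>.
  Unlike the norm, the integral over \<open>S\<close> carries no factor \<open>p / (2 * pi)\<close>.
\<close>

definition sampling_enorm :: "ennreal \<Rightarrow> nat \<Rightarrow> complex set \<Rightarrow> (complex \<Rightarrow> complex) \<Rightarrow> ennreal" where
  "sampling_enorm p k S f =
     (if p = \<infinity>
      then (SUP z\<in>S. ennreal (norm ((deriv ^^ k) f z) / (1 + norm z) ^ k * exp (- ((norm z)\<^sup>2 / 2))))
      else (let q = enn2real p in
        epowr (\<integral>\<^sup>+ z\<in>S. ennreal (norm ((deriv ^^ k) f z) powr q / (1 + norm z) powr (real k * q)
                 * exp (- (q/2) * (norm z)\<^sup>2)) \<partial>lebesgue) (1 / q)))"

definition sampling_set ::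
  "ennreal \<Rightarrow> nat \<Rightarrow> complex set \<Rightarrow> (complex \<Rightarrow> complex) set \<Rightarrow> bool" where
  "sampling_set p k S M \<longleftrightarrow>
     (\<exists>\<delta>>0. \<forall>f\<in>M. ennreal \<delta> * fock_enorm p f \<le> sampling_enorm p k S f)"

end

(*
  Testing a bounded operator D = D_(u,psi,n) on normalised reproducing kernels shows that L is bounded,
  and this growth condition forces psi(z) = a z + b with a \<noteq> 0.

  D has the same range as its restriction to F^0_(p,n), which is injective. The images under D of the
  balls of F^0_(p,n) are closed (Montel's theorem and Fatou's lemma), so if the range is closed, Baire's
  theorem gives one of them interior in it, and D is bounded below on F^0_(p,n). The converse is the
  same compactness argument.

  For w = psi(z), |D f(z)| e^(-|z|^2/2) is |f^(n)(w)| (1 + |w|)^(-n) e^(-|w|^2/2) times a bounded function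
  that agrees with L up to constants away from psi(z) = 0. The second factor is controlled by the norm
  of f. Hence the part of ||D f|| outside G^eps is at most a small multiple of ||f||, apart from the
  neighbourhood of w = 0; there one uses smallness of the area if p < \<infinity> and the maximum principle if
  p = \<infinity>.
*)
theory Submission
  imports Defs "HOL-Complex_Analysis.Complex_Analysis"
begin

section \<open>Area measure on the plane\<close>

text \<open>The weight \<open>(1 + |w|)^n\<close> is what Cauchy's estimate produces on circles of
  radius \<open>1 / (1 + |w|)\<close>, on which \<open>exp (|z|^2 / 2)\<close> varies by a bounded
  factor only. So the weighted n-th derivative is controlled by the weighted function at unit scale.
  The obstacle is that \<open>L\<close> carries \<open>|\<psi> z|^n\<close> instead: for n > 0 it
  vanishes with \<open>\<psi>\<close>, and every G^\<epsilon> misses a neighbourhood of w = 0,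
  however small \<epsilon> is. A supremum does not shrink with the area of that neighbourhood, hence
  the different arguments for finite and infinite exponents. Affinity of \<open>\<psi>\<close> makes
  w = \<open>\<psi> z\<close> a change of variables with constant Jacobian, and makes G^\<epsilon>
  open. Baire's theorem is applied directly rather than through the open mapping theorem: balls are
  compact for locally uniform convergence, so their images need not be replaced by closures. For
  finite p the estimates are proved for integrals of q-th powers, in which error terms simply
  add.\<close>

lemma lborel_complex_eq_distr:
  "distr (lborel \<Otimes>\<^sub>M lborel) borel (\<lambda>(x, y). Complex x y) = lborel"
proof (rule lborel_eqI[symmetric])
  have meas [measurable]: "(\<lambda>(x, y). Complex x y) \<in> borel_measurable (lborel \<Otimes>\<^sub>M lborel)"
    unfolding borel_measurable_complex_iff by (simp add: case_prod_unfold)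
  fix l u :: complex
  assume le: "\<And>b. b \<in> Basis \<Longrightarrow> l \<bullet> b \<le> u \<bullet> b"
  have r: "Re l \<le> Re u" "Im l \<le> Im u"
    using le[of 1] le[of \<i>] by (auto simp: Basis_complex_def)
  have vim: "(\<lambda>(x, y). Complex x y) -` box l u \<inter> space (lborel \<Otimes>\<^sub>M lborel) =
      box (Re l) (Re u) \<times> box (Im l) (Im u)"
    by (auto simp: box_def Basis_complex_def space_pair_measure)
  have "emeasure (distr (lborel \<Otimes>\<^sub>M lborel) borel (\<lambda>(x, y). Complex x y)) (box l u) =
      emeasure (lborel \<Otimes>\<^sub>M lborel) (box (Re l) (Re u) \<times> box (Im l) (Im u))"
    by (subst emeasure_distr[OF meas]) (auto simp: vim)
  also have "\<dots> = ennreal ((Re u - Re l) * (Im u - Im l))"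
    using r by (subst lborel.emeasure_pair_measure_Times) (auto simp: ennreal_mult)
  also have "(Re u - Re l) * (Im u - Im l) = (\<Prod>b\<in>Basis. (u - l) \<bullet> b)"
    by (auto simp: Basis_complex_def)
  finally show "emeasure (distr (lborel \<Otimes>\<^sub>M lborel) borel (\<lambda>(x, y). Complex x y)) (box l u) =
      ennreal (\<Prod>b\<in>Basis. (u - l) \<bullet> b)" .
qed simp

lemma borel_measurable_Complex [measurable (raw)]:
  assumes [measurable]: "f \<in> borel_measurable M" "g \<in> borel_measurable M"
  shows "(\<lambda>x. Complex (f x) (g x)) \<in> borel_measurable M"
  unfolding borel_measurable_complex_iff by simp

text \<open>Both orders of integration are provided because multiplication by a fixed number is
  handled below by substituting in one real variable at a time.\<close>

lemma nn_integral_complex: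
  assumes F [measurable]: "F \<in> borel_measurable borel"
  shows "(\<integral>\<^sup>+z. F z \<partial>lborel) = (\<integral>\<^sup>+x. \<integral>\<^sup>+y. F (Complex x y) \<partial>lborel \<partial>lborel)"
    and "(\<integral>\<^sup>+z. F z \<partial>lborel) = (\<integral>\<^sup>+y. \<integral>\<^sup>+x. F (Complex x y) \<partial>lborel \<partial>lborel)"
proof -
  have "(\<integral>\<^sup>+z. F z \<partial>lborel) = (\<integral>\<^sup>+z. (case z of (x, y) \<Rightarrow> F (Complex x y)) \<partial>(lborel \<Otimes>\<^sub>M lborel))"
    by (subst lborel_complex_eq_distr[symmetric], subst nn_integral_distr)
      (auto simp: case_prod_unfold)
  then show *: "(\<integral>\<^sup>+z. F z \<partial>lborel) = (\<integral>\<^sup>+x. \<integral>\<^sup>+y. F (Complex x y) \<partial>lborel \<partial>lborel)"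
    by (simp add: lborel.nn_integral_fst[symmetric])
  show "(\<integral>\<^sup>+z. F z \<partial>lborel) = (\<integral>\<^sup>+y. \<integral>\<^sup>+x. F (Complex x y) \<partial>lborel \<partial>lborel)"
    unfolding * by (rule lborel_pair.Fubini') measurable
qed

lemma nn_integral_complex_add:
  fixes b :: complex
  assumes [measurable]: "F \<in> borel_measurable borel"
  shows "(\<integral>\<^sup>+z. F (b + z) \<partial>lborel) = (\<integral>\<^sup>+z. F z \<partial>lborel)"
  by (subst (2) lborel_distr_plus[of b, symmetric]) (simp add: nn_integral_distr)

text \<open>If \<open>Re a \<noteq> 0\<close>, multiplication by \<open>a\<close> is a composition of one-variable affine substitutions.\<close>

lemma nn_integral_complex_mult_aux:
  fixes a :: complex
  assumes F [measurable]: "F \<in> borel_measurable borel" and a: "Re a \<noteq> 0"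
  shows "(\<integral>\<^sup>+z. F z \<partial>lborel) = ennreal ((norm a)\<^sup>2) * (\<integral>\<^sup>+z. F (a * z) \<partial>lborel)"
proof -
  define \<alpha> \<beta> where "\<alpha> = Re a" and "\<beta> = Im a"
  define N where "N = \<alpha>\<^sup>2 + \<beta>\<^sup>2"
  have \<alpha>: "\<alpha> \<noteq> 0" "N > 0" using a by (auto simp: \<alpha>_def N_def sum_power2_gt_zero_iff)
  \<comment> \<open>The imaginary part of \<open>a * Complex x y\<close> equals
    \<open>\<beta> / \<alpha>\<close> times its real part plus \<open>N / \<alpha> * y\<close>. For
    fixed y the real part is an affine function of x with slope \<open>\<alpha>\<close>; exchanging
    the order then leaves an affine function of y with slope \<open>N / \<alpha>\<close>. The
    product of the slopes is \<open>N\<close>, the Jacobian.\<close>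
  have inner: "(\<integral>\<^sup>+x. F (Complex x (\<beta> / \<alpha> * x + N / \<alpha> * y)) \<partial>lborel) =
      ennreal \<bar>\<alpha>\<bar> * (\<integral>\<^sup>+x. F (a * Complex x y) \<partial>lborel)" for y
  proof -
    have "Complex (- \<beta> * y + \<alpha> * x) (\<beta> / \<alpha> * (- \<beta> * y + \<alpha> * x) + N / \<alpha> * y) = a * Complex x y" for x
      using \<alpha> by (auto simp: complex_eq_iff \<alpha>_def[symmetric] \<beta>_def[symmetric] N_def field_simps power2_eq_square)
    then show ?thesis
      using nn_integral_real_affine[of "\<lambda>x. F (Complex x (\<beta> / \<alpha> * x + N / \<alpha> * y))" \<alpha> "- \<beta> * y"] \<alpha>
      by (simp del: minus_mult_minus mult_minus_left)
  qed
  have "ennreal \<bar>\<alpha>\<bar> * (\<integral>\<^sup>+z. F (a * z) \<partial>lborel) =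
      (\<integral>\<^sup>+y. ennreal \<bar>\<alpha>\<bar> * (\<integral>\<^sup>+x. F (a * Complex x y) \<partial>lborel) \<partial>lborel)"
    by (subst nn_integral_complex(2)) (auto simp: nn_integral_cmult)
  also have "\<dots> = (\<integral>\<^sup>+y. (\<integral>\<^sup>+x. F (Complex x (\<beta> / \<alpha> * x + N / \<alpha> * y)) \<partial>lborel) \<partial>lborel)"
    by (simp only: inner)
  also have "\<dots> = (\<integral>\<^sup>+x. (\<integral>\<^sup>+y. F (Complex x (\<beta> / \<alpha> * x + N / \<alpha> * y)) \<partial>lborel) \<partial>lborel)"
    by (rule lborel_pair.Fubini') measurable
  finally have 1: "ennreal \<bar>\<alpha>\<bar> * (\<integral>\<^sup>+z. F (a * z) \<partial>lborel) =
     (\<integral>\<^sup>+x. (\<integral>\<^sup>+y. F (Complex x (\<beta> / \<alpha> * x + N / \<alpha> * y)) \<partial>lborel) \<partial>lborel)" .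
  have "ennreal \<bar>N / \<alpha>\<bar> * (ennreal \<bar>\<alpha>\<bar> * (\<integral>\<^sup>+z. F (a * z) \<partial>lborel)) =
      (\<integral>\<^sup>+x. ennreal \<bar>N / \<alpha>\<bar> * (\<integral>\<^sup>+y. F (Complex x (\<beta> / \<alpha> * x + N / \<alpha> * y)) \<partial>lborel) \<partial>lborel)"
    unfolding 1 by (subst nn_integral_cmult) auto
  also have "\<dots> = (\<integral>\<^sup>+x. (\<integral>\<^sup>+y. F (Complex x y) \<partial>lborel) \<partial>lborel)"
  proof (intro nn_integral_cong)
    fix x
    show "ennreal \<bar>N / \<alpha>\<bar> * (\<integral>\<^sup>+y. F (Complex x (\<beta> / \<alpha> * x + N / \<alpha> * y)) \<partial>lborel) =
      (\<integral>\<^sup>+y. F (Complex x y) \<partial>lborel)"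
      using nn_integral_real_affine[of "\<lambda>y. F (Complex x y)" "N / \<alpha>" "\<beta> / \<alpha> * x"] \<alpha> by simp
  qed
  also have "\<dots> = (\<integral>\<^sup>+z. F z \<partial>lborel)"
    by (subst nn_integral_complex(1)) auto
  finally have "(\<integral>\<^sup>+z. F z \<partial>lborel) = ennreal \<bar>N / \<alpha>\<bar> * ennreal \<bar>\<alpha>\<bar> * (\<integral>\<^sup>+z. F (a * z) \<partial>lborel)"
    by (simp add: mult.assoc)
  also have "ennreal \<bar>N / \<alpha>\<bar> * ennreal \<bar>\<alpha>\<bar> = ennreal ((norm a)\<^sup>2)"
    using \<alpha> by (simp add: abs_divide N_def cmod_power2 \<alpha>_def \<beta>_def flip: ennreal_mult)
  finally show ?thesis .
qed

text \<open>For affine \<open>\<psi>\<close> this is the substitution w = \<open>\<psi> z\<close>.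
  With b = 0 and |a| = 1 it is the rotation invariance behind the mean value inequality on
  discs.\<close>

lemma nn_integral_complex_affine:
  fixes a b :: complex
  assumes F [measurable]: "F \<in> borel_measurable borel" and a: "a \<noteq> 0"
  shows "(\<integral>\<^sup>+z. F z \<partial>lborel) = ennreal ((norm a)\<^sup>2) * (\<integral>\<^sup>+z. F (b + a * z) \<partial>lborel)"
proof -
  have "(\<integral>\<^sup>+z. G z \<partial>lborel) = ennreal ((norm a)\<^sup>2) * (\<integral>\<^sup>+z. G (a * z) \<partial>lborel)"
    if G [measurable]: "G \<in> borel_measurable borel" for G :: "complex \<Rightarrow> ennreal"
  proof (cases "Re a = 0")
    case True
    \<comment> \<open>A purely imaginary factor is a product of two factors with nonzero real part.\<close>
    define c where "c = a / Complex 1 1"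
    have "Im a \<noteq> 0" using True a by (simp add: complex_eq_iff)
    then have c: "Re c \<noteq> 0" "a = Complex 1 1 * c"
      using True by (simp_all add: c_def Re_divide complex_eq_iff)
    have "(\<integral>\<^sup>+z. G z \<partial>lborel) = ennreal ((norm (Complex 1 1))\<^sup>2) *
        (ennreal ((norm c)\<^sup>2) * (\<integral>\<^sup>+z. G (Complex 1 1 * (c * z)) \<partial>lborel))"
      using nn_integral_complex_mult_aux[OF G, of "Complex 1 1"]
        nn_integral_complex_mult_aux[of "\<lambda>z. G (Complex 1 1 * z)" c] c by simp
    then show ?thesis
      by (simp add: c norm_mult power_mult_distrib mult.assoc flip: ennreal_mult)
         (simp add: ennreal_mult mult.assoc)
  qed (use nn_integral_complex_mult_aux[OF G] in auto)
  from this[of "\<lambda>z. F (b + z)"] show ?thesis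
    using nn_integral_complex_add[OF F, of b] by simp
qed

text \<open>Only finiteness matters, so the one-dimensional Gaussian is dominated by a two-sided
  exponential; the planar one is a product.\<close>

lemma nn_integral_gaussian_finite:
  assumes c: "c > 0"
  shows "(\<integral>\<^sup>+z. ennreal (exp (- c * (norm (z::complex))\<^sup>2)) \<partial>lborel) < \<infinity>"
proof -
  have half: "(\<integral>\<^sup>+x. ennreal (exp (- x)) * indicator {0..} x \<partial>lborel) = ennreal 1"
  proof -
    have "((\<lambda>x::real. - exp (- x)) \<longlongrightarrow> 0) at_top"
      using tendsto_minus[OF filterlim_compose[OF exp_at_bot filterlim_uminus_at_bot_at_top]] by simp
    then have "(\<integral>\<^sup>+x. ennreal (exp (- x)) * indicator {0..} x \<partial>lborel) = ennreal (0 - (- exp (- 0)))"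
      by (intro nn_integral_FTC_atLeast) (auto intro!: derivative_eq_intros)
    then show ?thesis by simp
  qed
  have half': "(\<integral>\<^sup>+x. ennreal (exp x) * indicator {..0} x \<partial>lborel) = ennreal 1"
  proof -
    have "(\<integral>\<^sup>+x. ennreal (exp x) * indicator {..0} x \<partial>lborel) =
        (\<integral>\<^sup>+x. ennreal (exp (- x)) * indicator {..0} (- x::real) \<partial>lborel)"
      using nn_integral_real_affine[of "\<lambda>x. ennreal (exp x) * indicator {..0} x" "-1" 0] by simp
    also have "\<dots> = (\<integral>\<^sup>+x. ennreal (exp (- x)) * indicator {0..} x \<partial>lborel)"
      by (intro nn_integral_cong) (auto simp: indicator_def)
    finally show ?thesis using half by simp
  qed
  \<comment> \<open>The maximum of \<open>exp (\<bar>x\<bar> - c * x^2)\<close>, attained at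
    \<open>\<bar>x\<bar> = 1 / (2 * c)\<close>; the square completed below is centred there.\<close>
  define E where "E = exp (1 / (4 * c))"
  have le: "ennreal (exp (- c * x\<^sup>2)) \<le>
      ennreal E * (ennreal (exp (- x)) * indicator {0..} x + ennreal (exp x) * indicator {..0} x)" for x
  proof -
    have "0 \<le> c * (\<bar>x\<bar> - 1 / (2 * c))\<^sup>2" using c by simp
    also have "\<dots> = c * x\<^sup>2 - \<bar>x\<bar> + 1 / (4 * c)"
      using c by (simp add: power2_diff field_simps power2_eq_square)
    finally have "exp (- c * x\<^sup>2) \<le> exp (1 / (4 * c) + - \<bar>x\<bar>)" by simp
    also have "\<dots> = E * exp (- \<bar>x\<bar>)" by (simp only: exp_add E_def)
    finally have "ennreal (exp (- c * x\<^sup>2)) \<le> ennreal E * ennreal (exp (- \<bar>x\<bar>))"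
      by (simp add: E_def ennreal_leI flip: ennreal_mult)
    also have "\<dots> \<le> ennreal E * (ennreal (exp (- x)) * indicator {0..} x + ennreal (exp x) * indicator {..0} x)"
      by (intro mult_left_mono) (auto simp: indicator_def abs_if)
    finally show ?thesis .
  qed
  have "(\<integral>\<^sup>+x. ennreal (exp (- c * x\<^sup>2)) \<partial>lborel) \<le> (\<integral>\<^sup>+x. ennreal E *
      (ennreal (exp (- x)) * indicator {0..} x + ennreal (exp x) * indicator {..0} x) \<partial>lborel)"
    by (intro nn_integral_mono le)
  also have "\<dots> = ennreal E * (ennreal 1 + ennreal 1)"
    using half half' by (simp add: nn_integral_cmult nn_integral_add)
  also have "\<dots> < \<infinity>" by (simp add: ennreal_mult_less_top)
  finally have fin: "(\<integral>\<^sup>+x. ennreal (exp (- c * x\<^sup>2)) \<partial>lborel) < \<infinity>" .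
  have "(\<integral>\<^sup>+z. ennreal (exp (- c * (norm (z::complex))\<^sup>2)) \<partial>lborel) =
      (\<integral>\<^sup>+x. \<integral>\<^sup>+y. ennreal (exp (- c * x\<^sup>2)) * ennreal (exp (- c * y\<^sup>2)) \<partial>lborel \<partial>lborel)"
    by (subst nn_integral_complex(1))
      (auto simp: cmod_power2 algebra_simps simp flip: ennreal_mult exp_add)
  also have "\<dots> = (\<integral>\<^sup>+x. ennreal (exp (- c * x\<^sup>2)) \<partial>lborel) * (\<integral>\<^sup>+x. ennreal (exp (- c * x\<^sup>2)) \<partial>lborel)"
    by (simp add: nn_integral_cmult nn_integral_multc)
  also have "\<dots> < \<infinity>" using fin by (simp add: ennreal_mult_less_top)
  finally show ?thesis .
qed

section \<open>Local estimates for entire functions\<close>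

text \<open>Cauchy's formula at 0 for \<open>\<lambda>w. F (w * z)\<close> on the unit circle. The
  circle appears as the orbit of z under rotations, so that z can later be integrated over a disc
  without polar coordinates.\<close>

lemma has_integral_circle_mean:
  assumes "F holomorphic_on UNIV"
  shows "((\<lambda>t. F (exp (2 * of_real pi * \<i> * of_real t) * z)) has_integral F 0) {0..1}"
proof -
  have "(\<lambda>w. F (w * z)) holomorphic_on cball 0 1"
    by (intro holomorphic_on_compose_gen[OF _ assms, unfolded o_def] holomorphic_intros) auto
  then have "((\<lambda>w. F (w * z) / (w - 0)) has_contour_integral (2 * of_real pi * \<i> * F (0 * z))) (circlepath 0 1)"
    by (intro Cauchy_integral_circlepath_simple) auto
  then have "((\<lambda>t. F (exp (2 * of_real pi * \<i> * of_real t) * z) * (2 * of_real pi * \<i>)) has_integral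
      (2 * of_real pi * \<i> * F (0 * z))) {0..1}"
    unfolding has_contour_integral_def
    by (rule has_integral_eq[rotated])
      (simp add: vector_derivative_circlepath01, simp add: circlepath mult_ac)
  from has_integral_mult_left[OF this, of "1 / (2 * of_real pi * \<i>)"] show ?thesis
    by (simp add: field_simps)
qed

lemma powr_ge_tangent:
  fixes x a q :: real
  assumes "q \<ge> 1" "a > 0" "x \<ge> 0"
  shows "a powr q + q * a powr (q - 1) * (x - a) \<le> x powr q"
proof (cases "x = 0")
  case True
  have "a powr q = a powr (q - 1) * a" using assms powr_add[of a "q - 1" 1] by simp
  then show ?thesis using assms True by (simp add: algebra_simps mult_le_cancel_left1)
next
  case False
  have "x powr q - a powr q \<ge> (q * a powr (q - 1)) * (x - a)"
    by (rule convex_on_imp_above_tangent[OF powr_convex[OF assms(1)]])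
      (use assms False in \<open>auto intro!: derivative_eq_intros simp: interior_open\<close>)
  then show ?thesis by simp
qed

text \<open>Multiplying F by the unimodular number \<open>cnj (F 0) / a\<close> gives a function
  whose mean is |F 0| and whose real part is at most |F|. Integrating the tangent of the convex
  function t^q at t = |F 0| takes the place of Jensen's inequality.\<close>

lemma norm_powr_le_circle_mean:
  assumes F: "F holomorphic_on UNIV" and q: "q \<ge> 1"
  shows "ennreal (norm (F 0) powr q) \<le>
    (\<integral>\<^sup>+t\<in>{0..1}. ennreal (norm (F (exp (2 * of_real pi * \<i> * of_real t) * z)) powr q) \<partial>lborel)"
proof (cases "F 0 = 0")
  case False
  define a where "a = norm (F 0)"
  define G where "G t = F (exp (2 * of_real pi * \<i> * of_real t) * z)" for t :: real
  have a: "a > 0" using False by (simp add: a_def)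
  have contF: "continuous_on A F" for A
    using F holomorphic_on_imp_continuous_on continuous_on_subset by blast
  have cont: "continuous_on {0..1} (\<lambda>t. norm (G t) powr q)" unfolding G_def
    by (intro continuous_on_powr' continuous_intros continuous_on_compose2[OF contF[of UNIV]]) (use q in auto)
  then obtain I where I: "((\<lambda>t. norm (G t) powr q) has_integral I) {0..1}"
    using integrable_continuous_real integrable_integral by blast
  define h where "h t = a powr q + q * a powr (q - 1) * (Re (G t * (cnj (F 0) / a)) - a)" for t
  have "((\<lambda>t. Re (G t * (cnj (F 0) / a))) has_integral Re (F 0 * (cnj (F 0) / a))) {0..1}"
    using has_integral_Re[OF has_integral_mult_left[OF has_integral_circle_mean[OF F, of z]]]
    unfolding G_def .
  also have "Re (F 0 * (cnj (F 0) / a)) = a"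
    using a by (simp add: a_def cmod_power2 complex_mult_cnj power2_eq_square flip: of_real_divide of_real_power)
      (simp add: cmod_def real_div_sqrt power2_eq_square)
  finally have "(h has_integral (a powr q * 1 + q * a powr (q - 1) * (a - a * 1))) {0..1}"
    unfolding h_def
    by (intro has_integral_add has_integral_mult_right has_integral_diff)
      (use has_integral_const_real[of _ 0 1] in auto)
  moreover have "h t \<le> norm (G t) powr q" for t
  proof -
    have "Re (G t * (cnj (F 0) / a)) \<le> norm (G t * (cnj (F 0) / a))" by (rule complex_Re_le_cmod)
    also have "\<dots> = norm (G t)" using a by (simp add: norm_mult norm_divide a_def)
    finally have "h t \<le> a powr q + q * a powr (q - 1) * (norm (G t) - a)"
      unfolding h_def using q by (intro add_left_mono mult_left_mono) auto
    also have "\<dots> \<le> norm (G t) powr q" using q a by (intro powr_ge_tangent) auto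
    finally show ?thesis .
  qed
  ultimately have "a powr q \<le> I" using has_integral_le[OF _ I] by force
  moreover have "(\<integral>\<^sup>+t\<in>{0..1}. ennreal (norm (G t) powr q) \<partial>lborel) = ennreal I"
    by (rule nn_integral_has_integral_lebesgue'[OF _ I]) auto
  ultimately show ?thesis by (simp add: G_def a_def ennreal_leI)
qed auto

lemma emeasure_lborel_ball_complex:
  fixes c :: complex
  assumes "r \<ge> 0"
  shows "emeasure lborel (ball c r) = ennreal (pi * r\<^sup>2)"
  using emeasure_ball[OF assms, of c] by (simp add: unit_ball_vol_2)

text \<open>The circle inequality is integrated over all z in the disc. After exchanging the
  integrals, the inner one does not depend on the angle by rotation invariance, and the angle runs
  over an interval of length 1.\<close>

lemma norm_powr_le_disc_mean:
  assumes F: "F holomorphic_on UNIV" and q: "q \<ge> 1"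
  shows "ennreal (pi * norm (F 0) powr q) \<le> (\<integral>\<^sup>+z\<in>ball 0 1. ennreal (norm (F z) powr q) \<partial>lborel)"
proof -
  define E where "E t = exp (2 * of_real pi * \<i> * of_real t)" for t :: real
  have nE [simp]: "norm (E t) = 1" for t by (simp add: E_def)
  have nz: "E t \<noteq> 0" for t by (simp add: E_def)
  have contF: "continuous_on A F" for A
    using F holomorphic_on_imp_continuous_on continuous_on_subset by blast
  have [measurable]: "F \<in> borel_measurable borel"
    by (rule borel_measurable_continuous_onI) (rule contF)
  have [measurable]: "E \<in> borel_measurable borel"
    unfolding E_def by (intro borel_measurable_continuous_onI continuous_intros)
  let ?f = "\<lambda>z. ennreal (norm (F z) powr q) * indicator (ball 0 1) z"
  have [measurable]: "ball (0::complex) 1 \<in> sets borel" by simp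
  have [measurable]: "?f \<in> borel_measurable borel" by measurable
  have rot: "(\<integral>\<^sup>+z. ?f z \<partial>lborel) = (\<integral>\<^sup>+z. ennreal (norm (F (E t * z)) powr q) * indicator (ball 0 1) z \<partial>lborel)" for t
  proof -
    have "(\<integral>\<^sup>+z. ?f z \<partial>lborel) = (\<integral>\<^sup>+z. ?f (0 + E t * z) \<partial>lborel)"
      using nn_integral_complex_affine[of ?f "E t" 0] nz[of t] by simp
    also have "\<dots> = (\<integral>\<^sup>+z. ennreal (norm (F (E t * z)) powr q) * indicator (ball 0 1) z \<partial>lborel)"
      by (intro nn_integral_cong) (auto simp: indicator_def norm_mult)
    finally show ?thesis .
  qed
  have "ennreal (pi * norm (F 0) powr q) = (\<integral>\<^sup>+z. ennreal (norm (F 0) powr q) * indicator (ball (0::complex) 1) z \<partial>lborel)"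
    by (subst nn_integral_cmult_indicator)
      (simp_all add: emeasure_lborel_ball_complex mult.commute flip: ennreal_mult)
  also have "\<dots> \<le> (\<integral>\<^sup>+z. (\<integral>\<^sup>+t\<in>{0..1}. ennreal (norm (F (E t * z)) powr q) \<partial>lborel) * indicator (ball 0 1) z \<partial>lborel)"
    unfolding E_def by (intro nn_integral_mono mult_right_mono norm_powr_le_circle_mean F q) auto
  also have "\<dots> = (\<integral>\<^sup>+z. (\<integral>\<^sup>+t. ennreal (norm (F (E t * z)) powr q) * indicator {0..1} t * indicator (ball 0 1) z \<partial>lborel) \<partial>lborel)"
    by (subst nn_integral_multc) auto
  also have "\<dots> = (\<integral>\<^sup>+t. (\<integral>\<^sup>+z. ennreal (norm (F (E t * z)) powr q) * indicator {0..1} t * indicator (ball 0 1) z \<partial>lborel) \<partial>lborel)"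
    by (rule lborel_pair.Fubini') measurable
  also have "\<dots> = (\<integral>\<^sup>+t. indicator {0..1} (t::real) * (\<integral>\<^sup>+z. ?f z \<partial>lborel) \<partial>lborel)"
  proof (rule nn_integral_cong)
    fix t :: real
    show "(\<integral>\<^sup>+z. ennreal (norm (F (E t * z)) powr q) * indicator {0..1} t * indicator (ball 0 1) z \<partial>lborel) =
        indicator {0..1} t * (\<integral>\<^sup>+z. ?f z \<partial>lborel)"
      unfolding rot[of t] by (subst nn_integral_cmult[symmetric]) (auto simp: mult_ac)
  qed
  also have "\<dots> = (\<integral>\<^sup>+z. ?f z \<partial>lborel)"
    by (subst nn_integral_multc) auto
  finally show ?thesis .
qed

section \<open>Weighted modulus and weighted derivatives\<close>

definition wmod :: "(complex \<Rightarrow> complex) \<Rightarrow> complex \<Rightarrow> real" where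
  "wmod f z = norm (f z) * exp (- ((norm z)\<^sup>2 / 2))"

definition wder :: "nat \<Rightarrow> (complex \<Rightarrow> complex) \<Rightarrow> complex \<Rightarrow> real" where
  "wder n f z = norm ((deriv ^^ n) f z) / (1 + norm z) ^ n * exp (- ((norm z)\<^sup>2 / 2))"

lemma wmod_nonneg [simp]: "0 \<le> wmod f z"
  by (simp add: wmod_def)

lemma wder_nonneg [simp]: "0 \<le> wder n f z"
  by (simp add: wder_def)

lemma entire_continuous_on: "f holomorphic_on UNIV \<Longrightarrow> continuous_on A f"
  using holomorphic_on_imp_continuous_on continuous_on_subset by blast

lemma entire_measurable: "f holomorphic_on UNIV \<Longrightarrow> f \<in> borel_measurable borel"
  by (intro borel_measurable_continuous_onI entire_continuous_on)

lemma entire_higher_deriv: "f holomorphic_on UNIV \<Longrightarrow> (deriv ^^ n) f holomorphic_on UNIV"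
  by (intro holomorphic_higher_deriv) auto

lemma wmod_measurable:
  assumes "f holomorphic_on UNIV"
  shows "wmod f \<in> borel_measurable borel"
proof -
  have [measurable]: "f \<in> borel_measurable borel" by (rule entire_measurable[OF assms])
  show ?thesis unfolding wmod_def[abs_def] by measurable
qed

lemma wder_measurable:
  assumes "f holomorphic_on UNIV"
  shows "wder n f \<in> borel_measurable borel"
proof -
  have [measurable]: "(deriv ^^ n) f \<in> borel_measurable borel"
    by (rule entire_measurable[OF entire_higher_deriv[OF assms]])
  show ?thesis unfolding wder_def[abs_def] by measurable
qed

lemma norm_add_power2_complex:
  fixes w z :: complex
  shows "(norm (w + z))\<^sup>2 = (norm w)\<^sup>2 + 2 * Re (cnj w * z) + (norm z)\<^sup>2"
  unfolding cmod_power2 by (simp add: power2_eq_square algebra_simps)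

text \<open>
  The twist \<open>z \<mapsto> f (w + z) exp (- cnj w z - |w|\<^sup>2 / 2)\<close> carries the weight at \<open>w\<close> to the
  weight at \<open>0\<close>, so that the mean value inequality only has to be used at the origin.
\<close>

lemma wmod_powr_le_local_mean:
  assumes f: "f holomorphic_on UNIV" and q: "q \<ge> 1"
  shows "ennreal (wmod f w powr q) \<le>
    ennreal (exp (q / 2) / pi) * (\<integral>\<^sup>+z\<in>ball w 1. ennreal (wmod f z powr q) \<partial>lborel)"
proof -
  define F where "F z = f (w + z) * exp (- cnj w * z - (norm w)\<^sup>2 / 2)" for z
  have [measurable]: "wmod f \<in> borel_measurable borel" by (rule wmod_measurable[OF f])
  have [measurable]: "ball (w::complex) 1 \<in> sets borel" by simp
  have F: "F holomorphic_on UNIV" unfolding F_def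
    by (intro holomorphic_intros holomorphic_on_compose_gen[OF _ f, unfolded o_def]) auto
  have nF: "norm (F z) = wmod f (w + z) * exp ((norm z)\<^sup>2 / 2)" for z
  proof -
    have "norm (F z) = norm (f (w + z)) * exp (Re (- cnj w * z - (norm w)\<^sup>2 / 2))"
      by (simp only: F_def norm_mult norm_exp_eq_Re)
    also have "Re (- cnj w * z - (norm w)\<^sup>2 / 2) = - (norm (w + z))\<^sup>2 / 2 + (norm z)\<^sup>2 / 2"
      unfolding norm_add_power2_complex by (simp add: field_simps flip: of_real_power)
    finally show ?thesis unfolding wmod_def by (simp only: exp_add mult.assoc minus_divide_left)
  qed
  \<comment> \<open>On the unit disc the Gaussian factor left over by the twist is at most
    \<open>exp (1 / 2)\<close>; its q-th power is the constant of the statement, up to the area of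
    the disc.\<close>
  have le: "norm (F z) powr q \<le> exp (q / 2) * wmod f (w + z) powr q" if "norm z < 1" for z
  proof -
    have "norm (F z) \<le> exp (1 / 2) * wmod f (w + z)"
      using that unfolding nF by (subst mult.commute, intro mult_right_mono) (auto simp: power_le_one)
    then have "norm (F z) powr q \<le> (exp (1 / 2) * wmod f (w + z)) powr q"
      using q by (intro powr_mono2) auto
    also have "\<dots> = exp (q / 2) * wmod f (w + z) powr q"
      by (simp add: powr_mult exp_powr_real)
    finally show ?thesis .
  qed
  have "ennreal pi * ennreal (wmod f w powr q) = ennreal (pi * norm (F 0) powr q)"
    by (simp add: nF ennreal_mult)
  also have "\<dots> \<le> (\<integral>\<^sup>+z\<in>ball 0 1. ennreal (norm (F z) powr q) \<partial>lborel)"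
    by (rule norm_powr_le_disc_mean[OF F q])
  also have "\<dots> \<le> (\<integral>\<^sup>+z. ennreal (exp (q / 2)) * (ennreal (wmod f (w + z) powr q) * indicator (ball w 1) (w + z)) \<partial>lborel)"
    by (intro nn_integral_mono) (auto simp: indicator_def dist_norm le ennreal_leI simp flip: ennreal_mult)
  also have "\<dots> = ennreal (exp (q / 2)) * (\<integral>\<^sup>+z. ennreal (wmod f (w + z) powr q) * indicator (ball w 1) (w + z) \<partial>lborel)"
    by (subst nn_integral_cmult) auto
  also have "(\<integral>\<^sup>+z. ennreal (wmod f (w + z) powr q) * indicator (ball w 1) (w + z) \<partial>lborel) =
      (\<integral>\<^sup>+z\<in>ball w 1. ennreal (wmod f z powr q) \<partial>lborel)"
    by (rule nn_integral_complex_add[where F="\<lambda>z. ennreal (wmod f z powr q) * indicator (ball w 1) z"]) measurable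
  finally have "ennreal (1 / pi) * (ennreal pi * ennreal (wmod f w powr q)) \<le>
     ennreal (1 / pi) * (ennreal (exp (q / 2)) * (\<integral>\<^sup>+z\<in>ball w 1. ennreal (wmod f z powr q) \<partial>lborel))"
    by (intro mult_left_mono) auto
  then show ?thesis
    by (simp add: mult.assoc[symmetric] flip: ennreal_mult)
qed

text \<open>Cauchy's inequality on the circle of radius r = 1 / (1 + |w|). There |z|^2 exceeds |w|^2
  by at most 2 |w| r + r^2 \<le> 3, which costs \<open>exp (3 / 2)\<close>, and r^(-n) is exactly
  the factor that \<open>wder\<close> divides out. As r \<le> 1, a bound on the unit disc
  suffices.\<close>

lemma wder_le_of_wmod_le:
  assumes f: "f holomorphic_on UNIV" and B: "\<And>z. norm (z - w) \<le> 1 \<Longrightarrow> wmod f z \<le> B"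
  shows "wder n f w \<le> fact n * exp (3 / 2) * B"
proof -
  define r where "r = 1 / (1 + norm w)"
  have r: "0 < r" "r \<le> 1" "norm w * r \<le> 1" by (auto simp: r_def add_pos_nonneg)
  have B0: "0 \<le> B" using order_trans[OF wmod_nonneg B[of w]] by simp
  have "norm (f z) \<le> B * exp (3 / 2) * exp ((norm w)\<^sup>2 / 2)" if "norm (w - z) = r" for z
  proof -
    have "norm z \<le> norm w + r" using norm_triangle_ineq2[of z w] that by (simp add: norm_minus_commute)
    then have "(norm z)\<^sup>2 \<le> (norm w + r)\<^sup>2" by (intro power_mono) auto
    also have "\<dots> = (norm w)\<^sup>2 + 2 * (norm w * r) + r\<^sup>2" by (simp add: power2_sum)
    also have "\<dots> \<le> (norm w)\<^sup>2 + 2 * 1 + 1" using r by (intro add_mono mult_left_mono power_le_one) auto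
    finally have "(norm z)\<^sup>2 / 2 \<le> 3 / 2 + (norm w)\<^sup>2 / 2" by simp
    then have "exp ((norm z)\<^sup>2 / 2) \<le> exp (3 / 2 + (norm w)\<^sup>2 / 2)" by simp
    then have e: "exp ((norm z)\<^sup>2 / 2) \<le> exp (3 / 2) * exp ((norm w)\<^sup>2 / 2)" by (simp only: exp_add)
    have "norm (f z) = wmod f z * exp ((norm z)\<^sup>2 / 2)"
      by (simp add: wmod_def mult.assoc flip: exp_add)
    also have "\<dots> \<le> B * (exp (3 / 2) * exp ((norm w)\<^sup>2 / 2))"
      using that r B0 by (intro mult_mono B e) (auto simp: norm_minus_commute)
    finally show ?thesis by (simp add: mult_ac)
  qed
  then have "norm ((deriv ^^ n) f w) \<le> fact n * (B * exp (3 / 2) * exp ((norm w)\<^sup>2 / 2)) / r ^ n"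
    by (rule Cauchy_inequality[OF holomorphic_on_subset[OF f subset_UNIV] entire_continuous_on[OF f] r(1)])
  also have "\<dots> = fact n * (B * exp (3 / 2) * exp ((norm w)\<^sup>2 / 2)) * (1 + norm w) ^ n"
    by (simp add: r_def power_divide)
  finally have "norm ((deriv ^^ n) f w) / (1 + norm w) ^ n \<le> fact n * (B * exp (3 / 2) * exp ((norm w)\<^sup>2 / 2))"
    by (simp add: divide_le_eq add_pos_nonneg)
  then have "wder n f w \<le> fact n * (B * exp (3 / 2) * exp ((norm w)\<^sup>2 / 2)) * exp (- ((norm w)\<^sup>2 / 2))"
    unfolding wder_def by (intro mult_right_mono) auto
  also have "\<dots> = fact n * exp (3 / 2) * B" by (simp add: mult.assoc flip: exp_add)
  finally show ?thesis .
qed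

text \<open>Unit discs about points of the closed unit disc at w lie in the disc of radius 2 at w,
  so one integral over the latter bounds \<open>wmod f\<close> on all of the former.
  \<open>B\<close> is the q-th root of this bound; an infinite integral leaves nothing to
  prove.\<close>

lemma wder_powr_le_local_mean:
  assumes f: "f holomorphic_on UNIV" and q: "q \<ge> 1"
  shows "ennreal (wder n f w powr q) \<le> ennreal ((fact n * exp (3 / 2)) powr q * (exp (q / 2) / pi)) *
    (\<integral>\<^sup>+z\<in>ball w 2. ennreal (wmod f z powr q) \<partial>lborel)" (is "_ \<le> ennreal ?C * ?X")
proof (cases "?X = \<infinity>")
  case False
  then obtain X where X: "?X = ennreal X" "X \<ge> 0" by (cases "?X") auto
  define B where "B = (exp (q / 2) / pi * X) powr (1 / q)"
  have "wmod f z \<le> B" if z: "norm (z - w) \<le> 1" for z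
  proof -
    have "ennreal (wmod f z powr q) \<le>
        ennreal (exp (q / 2) / pi) * (\<integral>\<^sup>+\<zeta>\<in>ball z 1. ennreal (wmod f \<zeta> powr q) \<partial>lborel)"
      by (rule wmod_powr_le_local_mean[OF f q])
    also have "\<dots> \<le> ennreal (exp (q / 2) / pi) * ?X"
    proof -
      have "ball z 1 \<subseteq> ball w 2"
      proof
        fix x assume "x \<in> ball z 1"
        then show "x \<in> ball w 2"
          using z dist_triangle[of w x z] by (simp add: dist_norm norm_minus_commute)
      qed
      then have "(\<integral>\<^sup>+\<zeta>\<in>ball z 1. ennreal (wmod f \<zeta> powr q) \<partial>lborel) \<le> ?X"
        by (intro nn_integral_mono mult_left_mono) (auto simp: indicator_def)
      then show ?thesis by (intro mult_left_mono) auto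
    qed
    finally have "ennreal (wmod f z powr q) \<le> ennreal (exp (q / 2) / pi * X)"
      unfolding X(1) using X(2) by (subst ennreal_mult) auto
    then have "wmod f z powr q \<le> exp (q / 2) / pi * X"
      using X by (metis ennreal_le_iff mult_nonneg_nonneg divide_nonneg_nonneg exp_ge_zero pi_ge_zero)
    then have "(wmod f z powr q) powr (1 / q) \<le> B"
      unfolding B_def using q by (intro powr_mono2) auto
    then show ?thesis using q by (simp add: powr_powr)
  qed
  then have "wder n f w \<le> fact n * exp (3 / 2) * B" by (rule wder_le_of_wmod_le[OF f])
  then have "wder n f w powr q \<le> (fact n * exp (3 / 2) * B) powr q" using q by (intro powr_mono2) auto
  also have "\<dots> = (fact n * exp (3 / 2)) powr q * B powr q"
    by (rule powr_mult)
  also have "B powr q = exp (q / 2) / pi * X" using X q by (simp add: B_def powr_powr)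
  finally show ?thesis using X by (simp add: ennreal_leI mult.assoc flip: ennreal_mult)
qed (simp add: ennreal_mult_top)

text \<open>Without the root and the normalising factor, inequalities between norms become
  inequalities between integrals that can be split and added.\<close>

definition fint :: "real \<Rightarrow> (complex \<Rightarrow> complex) \<Rightarrow> ennreal" where
  "fint q f = (\<integral>\<^sup>+z. ennreal (wmod f z powr q) \<partial>lborel)"

definition dint :: "real \<Rightarrow> nat \<Rightarrow> complex set \<Rightarrow> (complex \<Rightarrow> complex) \<Rightarrow> ennreal" where
  "dint q n S f = (\<integral>\<^sup>+z\<in>S. ennreal (wder n f z powr q) \<partial>lborel)"

lemma wmod_powr_le_fint:
  assumes "f holomorphic_on UNIV" "q \<ge> 1"
  shows "ennreal (wmod f w powr q) \<le> ennreal (exp (q / 2) / pi) * fint q f"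
proof -
  have "(\<integral>\<^sup>+z\<in>ball w 1. ennreal (wmod f z powr q) \<partial>lborel) \<le> fint q f"
    unfolding fint_def by (intro nn_integral_mono) (auto simp: indicator_def)
  from mult_left_mono[OF this, of "ennreal (exp (q / 2) / pi)"] show ?thesis
    using wmod_powr_le_local_mean[OF assms, of w] by (auto intro: order_trans)
qed

text \<open>The global bound comes from integrating the local one over w: after Fubini each z is
  counted with the area 4 pi of a disc of radius 2. One constant serves both bounds, hence the
  maximum at the end.\<close>

lemma wder_powr_le_fint:
  assumes q: "q \<ge> 1"
  obtains C where "C > 0" "\<And>f w. f holomorphic_on UNIV \<Longrightarrow> ennreal (wder n f w powr q) \<le> ennreal C * fint q f"
    "\<And>f. f holomorphic_on UNIV \<Longrightarrow> dint q n UNIV f \<le> ennreal C * fint q f"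
proof -
  define C where "C = (fact n * exp (3 / 2)) powr q * (exp (q / 2) / pi)"
  have C: "C > 0" by (simp add: C_def)
  have 1: "ennreal (wder n f w powr q) \<le> ennreal C * fint q f" if f: "f holomorphic_on UNIV" for f w
  proof -
    have "(\<integral>\<^sup>+z\<in>ball w 2. ennreal (wmod f z powr q) \<partial>lborel) \<le> fint q f"
      unfolding fint_def by (intro nn_integral_mono) (auto simp: indicator_def)
    from mult_left_mono[OF this, of "ennreal C"] show ?thesis
      using wder_powr_le_local_mean[OF f q, of n w] unfolding C_def by (auto intro: order_trans)
  qed
  have 2: "dint q n UNIV f \<le> ennreal (C * (4 * pi)) * fint q f" if f: "f holomorphic_on UNIV" for f
  proof -
    have [measurable]: "wmod f \<in> borel_measurable borel" by (rule wmod_measurable[OF f])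
    have [measurable]: "Measurable.pred (borel \<Otimes>\<^sub>M borel) (\<lambda>x. dist (fst x) (snd x :: complex) < 2)"
      by measurable
    have "dint q n UNIV f \<le> (\<integral>\<^sup>+w. ennreal C * (\<integral>\<^sup>+z\<in>ball w 2. ennreal (wmod f z powr q) \<partial>lborel) \<partial>lborel)"
      unfolding dint_def C_def by (rule nn_integral_mono) (simp only: indicator_UNIV mult_1_right wder_powr_le_local_mean[OF f q])
    also have "\<dots> = (\<integral>\<^sup>+w. (\<integral>\<^sup>+z. ennreal C * (ennreal (wmod f z powr q) * (if dist w z < 2 then 1 else 0)) \<partial>lborel) \<partial>lborel)"
      by (subst nn_integral_cmult[symmetric])
        (auto intro!: nn_integral_cong simp: indicator_def)
    also have "\<dots> = (\<integral>\<^sup>+z. (\<integral>\<^sup>+w. ennreal C * (ennreal (wmod f z powr q) * (if dist w z < 2 then 1 else 0)) \<partial>lborel) \<partial>lborel)"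
      by (rule lborel_pair.Fubini') measurable
    also have "\<dots> = (\<integral>\<^sup>+z. (\<integral>\<^sup>+w. ennreal C * ennreal (wmod f z powr q) * indicator (ball z 2) w \<partial>lborel) \<partial>lborel)"
      by (intro nn_integral_cong) (auto simp: indicator_def dist_commute)
    also have "\<dots> = (\<integral>\<^sup>+z. ennreal (C * (4 * pi)) * ennreal (wmod f z powr q) \<partial>lborel)"
      using C by (intro nn_integral_cong, subst nn_integral_cmult_indicator)
        (simp_all add: emeasure_lborel_ball_complex mult_ac flip: ennreal_mult)
    also have "\<dots> = ennreal (C * (4 * pi)) * fint q f"
      unfolding fint_def by (subst nn_integral_cmult) auto
    finally show ?thesis .
  qed
  show thesis
  proof (rule that[of "max C (C * (4 * pi))"])
    show "ennreal (wder n f w powr q) \<le> ennreal (max C (C * (4 * pi))) * fint q f" if "f holomorphic_on UNIV" for f w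
      by (rule order_trans[OF 1[OF that]]) (intro mult_right_mono ennreal_leI; simp)
    show "dint q n UNIV f \<le> ennreal (max C (C * (4 * pi))) * fint q f" if "f holomorphic_on UNIV" for f
      by (rule order_trans[OF 2[OF that]]) (intro mult_right_mono ennreal_leI; simp)
  qed (use C in auto)
qed

section \<open>The Fock norm\<close>

lemma epowr_cmult:
  assumes "c > 0"
  shows "epowr (ennreal c * X) r = ennreal (c powr r) * epowr X r"
proof (cases X)
  case (real x)
  then show ?thesis
    using assms by (simp add: epowr_def powr_mult flip: ennreal_mult)
next
  case top
  then show ?thesis
    using assms by (simp add: epowr_def ennreal_mult_top)
qed

lemma epowr_le_ennreal_iff:
  assumes "c \<ge> 0" "q > 0"
  shows "epowr X (1 / q) \<le> ennreal c \<longleftrightarrow> X \<le> ennreal (c powr q)"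
proof (cases X)
  case (real x)
  have "x powr (1 / q) \<le> c \<longleftrightarrow> x \<le> c powr q"
  proof
    assume "x powr (1 / q) \<le> c"
    then have "(x powr (1 / q)) powr q \<le> c powr q" using assms by (intro powr_mono2) auto
    then show "x \<le> c powr q" using real assms by (simp add: powr_powr)
  next
    assume "x \<le> c powr q"
    then have "x powr (1 / q) \<le> (c powr q) powr (1 / q)" using assms real by (intro powr_mono2) auto
    then show "x powr (1 / q) \<le> c" using assms by (simp add: powr_powr)
  qed
  then show ?thesis using real assms by (simp add: epowr_def)
qed (simp add: epowr_def top_unique)

lemma epowr_le_iff:
  assumes "q > 0"
  shows "epowr X (1 / q) \<le> epowr Y (1 / q) \<longleftrightarrow> X \<le> Y"
proof (cases Y)
  case (real y)
  then show ?thesis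
    using assms epowr_le_ennreal_iff[of "y powr (1 / q)" q X]
    by (simp add: epowr_def[of "ennreal y"] powr_powr)
qed (simp add: epowr_def)

text \<open>Taking q-th powers turns c into c^q, so whether a lower bound exists does not depend on
  whether it is stated for norms or for integrals.\<close>

lemma epowr_bounded_below_iff:
  assumes q: "q > 0"
  shows "(\<exists>c>0. \<forall>f\<in>M. ennreal c * epowr (A f) (1 / q) \<le> epowr (B f) (1 / q)) \<longleftrightarrow>
    (\<exists>c>0. \<forall>f\<in>M. ennreal c * A f \<le> B f)"
proof -
  have *: "ennreal c * epowr (A f) (1 / q) = epowr (ennreal (c powr q) * A f) (1 / q)" if "c > 0" for c f
    using that q by (subst epowr_cmult) (auto simp: powr_powr)
  show ?thesis
  proof
    assume "\<exists>c>0. \<forall>f\<in>M. ennreal c * epowr (A f) (1 / q) \<le> epowr (B f) (1 / q)"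
    then obtain c where c: "c > 0" "\<forall>f\<in>M. ennreal c * epowr (A f) (1 / q) \<le> epowr (B f) (1 / q)" by blast
    then have "\<forall>f\<in>M. ennreal (c powr q) * A f \<le> B f" using q by (simp add: * epowr_le_iff)
    then show "\<exists>c>0. \<forall>f\<in>M. ennreal c * A f \<le> B f" using c(1) by (intro exI[of _ "c powr q"]) auto
  next
    assume "\<exists>c>0. \<forall>f\<in>M. ennreal c * A f \<le> B f"
    then obtain c where c: "c > 0" "\<forall>f\<in>M. ennreal c * A f \<le> B f" by blast
    have "\<forall>f\<in>M. ennreal (c powr (1 / q)) * epowr (A f) (1 / q) \<le> epowr (B f) (1 / q)"
      using c q by (subst *) (auto simp: powr_powr epowr_le_iff)
    then show "\<exists>c>0. \<forall>f\<in>M. ennreal c * epowr (A f) (1 / q) \<le> epowr (B f) (1 / q)"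
      using c(1) by (intro exI[of _ "c powr (1 / q)"]) auto
  qed
qed

section \<open>Norm and sampling functional as weighted suprema and integrals\<close>

lemma enn2real_exponent_ge_1:
  assumes "1 \<le> p" "p \<noteq> \<infinity>"
  shows "1 \<le> enn2real p"
  using assms by (cases p) (auto simp: ennreal_le_iff2 simp flip: ennreal_1)

lemma wmod_powr: "wmod f z powr q = norm (f z) powr q * exp (- (q / 2) * (norm z)\<^sup>2)"
  by (simp add: wmod_def powr_mult exp_powr_real)

lemma wder_powr: "wder k f z powr q =
    norm ((deriv ^^ k) f z) powr q / (1 + norm z) powr (real k * q) * exp (- (q / 2) * (norm z)\<^sup>2)"
proof -
  have "((1 + norm z) ^ k) powr q = (1 + norm z) powr (real k * q)"
    by (simp add: powr_powr add_pos_nonneg flip: powr_realpow)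
  then show ?thesis
    by (simp add: wder_def powr_mult powr_divide exp_powr_real)
qed

lemma fock_enorm_infinity: "p = \<infinity> \<Longrightarrow> fock_enorm p f = (SUP z. ennreal (wmod f z))"
  by (simp add: fock_enorm_def wmod_def)

lemma fock_enorm_finite:
  assumes "p \<noteq> \<infinity>"
  shows "fock_enorm p f = epowr (ennreal (enn2real p / (2 * pi)) * fint (enn2real p) f) (1 / enn2real p)"
  using assms by (simp add: fock_enorm_def Let_def fint_def wmod_powr nn_integral_completion)

lemma sampling_enorm_infinity: "p = \<infinity> \<Longrightarrow> sampling_enorm p k S f = (SUP z\<in>S. ennreal (wder k f z))"
  by (simp add: sampling_enorm_def wder_def)

lemma sampling_enorm_finite:
  assumes "p \<noteq> \<infinity>"
  shows "sampling_enorm p k S f = epowr (dint (enn2real p) k S f) (1 / enn2real p)"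
  using assms by (simp add: sampling_enorm_def Let_def dint_def wder_powr nn_integral_completion)

lemma fock_enorm_le_iff:
  assumes p: "1 \<le> p" "p \<noteq> \<infinity>" and c: "c \<ge> 0"
  shows "fock_enorm p f \<le> ennreal c \<longleftrightarrow> fint (enn2real p) f \<le> ennreal (2 * pi / enn2real p * c powr enn2real p)"
proof -
  define q where "q = enn2real p"
  have q: "q \<ge> 1" using enn2real_exponent_ge_1[OF p] by (simp add: q_def)
  have "fock_enorm p f \<le> ennreal c \<longleftrightarrow> ennreal (q / (2 * pi)) * fint q f \<le> ennreal (c powr q)"
    using fock_enorm_finite[OF p(2)] epowr_le_ennreal_iff[OF c] q by (simp add: q_def)
  also have "\<dots> \<longleftrightarrow> fint q f \<le> ennreal (2 * pi / q * c powr q)"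
  proof (cases "fint q f")
    case (real x)
    then show ?thesis using q by (simp add: field_simps flip: ennreal_mult)
  next
    case top
    then show ?thesis using q by (simp add: ennreal_mult_top top_unique)
  qed
  finally show ?thesis by (simp add: q_def)
qed

lemma wmod_le_fock_enorm:
  assumes p: "1 \<le> p"
  obtains C where "C > 0" "\<And>f w. f holomorphic_on UNIV \<Longrightarrow> ennreal (wmod f w) \<le> ennreal C * fock_enorm p f"
proof (cases "p = \<infinity>")
  case True
  show thesis
    by (rule that[of 1]) (auto simp: fock_enorm_infinity[OF True] intro: SUP_upper)
next
  case False
  define q where "q = enn2real p"
  have q: "q \<ge> 1" using enn2real_exponent_ge_1[OF p False] by (simp add: q_def)
  \<comment> \<open>The constant \<open>exp (q / 2) / pi\<close> of the mean value inequality times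
    the \<open>2 * pi / q\<close> that undoes the normalisation of the norm, followed by the q-th
    root.\<close>
  define C where "C = (2 * exp (q / 2) / q) powr (1 / q)"
  show thesis
  proof (rule that[of C])
    show "C > 0" using q by (simp add: C_def)
    fix f :: "complex \<Rightarrow> complex" and w assume f: "f holomorphic_on UNIV"
    show "ennreal (wmod f w) \<le> ennreal C * fock_enorm p f"
    proof (cases "fock_enorm p f")
      case (real c)
      then have "fint q f \<le> ennreal (2 * pi / q * c powr q)"
        using fock_enorm_le_iff[OF p False, of c f] by (simp add: q_def)
      then have "ennreal (wmod f w powr q) \<le> ennreal (exp (q / 2) / pi) * ennreal (2 * pi / q * c powr q)"
        using wmod_powr_le_fint[OF f q, of w] by (meson mult_left_mono order_trans zero_le)
      also have "\<dots> = ennreal ((exp (q / 2) / pi) * (2 * pi / q * c powr q))"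
        using q by (subst ennreal_mult) auto
      also have "(exp (q / 2) / pi) * (2 * pi / q * c powr q) = 2 * exp (q / 2) / q * c powr q" by simp
      finally have "wmod f w powr q \<le> 2 * exp (q / 2) / q * c powr q"
        using q by (subst (asm) ennreal_le_iff) auto
      then have "(wmod f w powr q) powr (1 / q) \<le> (2 * exp (q / 2) / q * c powr q) powr (1 / q)"
        using q by (intro powr_mono2) auto
      also have "\<dots> = C * c" unfolding C_def
        by (subst powr_mult) (use q real in \<open>auto simp: powr_powr\<close>)
      finally have "wmod f w \<le> C * c" using q by (simp add: powr_powr)
      then show ?thesis using real \<open>C > 0\<close> by (simp add: ennreal_leI flip: ennreal_mult)
    qed (use \<open>C > 0\<close> in \<open>simp add: ennreal_mult_top\<close>)
  qed
qed

text \<open>Lower semicontinuity of the norm under mere pointwise convergence. It keeps the limits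
  supplied by Montel's theorem in the same ball, and also yields completeness.\<close>

lemma fock_enorm_le_of_tendsto:
  assumes p: "1 \<le> p" and f: "\<And>k. f k holomorphic_on UNIV" and le: "\<And>k. fock_enorm p (f k) \<le> c"
    and lim: "\<And>z. (\<lambda>k. f k z) \<longlonglongrightarrow> g z"
  shows "fock_enorm p g \<le> c"
proof (cases "c = \<infinity>")
  case False
  then obtain c' where c: "c = ennreal c'" "c' \<ge> 0" by (cases c) auto
  have lim': "(\<lambda>k. wmod (f k) z) \<longlonglongrightarrow> wmod g z" for z
    unfolding wmod_def by (intro tendsto_intros lim)
  show ?thesis
  proof (cases "p = \<infinity>")
    case True
    have "wmod (f k) z \<le> c'" for k z
    proof -
      have "ennreal (wmod (f k) z) \<le> fock_enorm p (f k)"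
        unfolding fock_enorm_infinity[OF True] by (auto intro: SUP_upper)
      also have "\<dots> \<le> ennreal c'" using le c by simp
      finally show ?thesis using c by simp
    qed
    then have "wmod g z \<le> c'" for z using LIMSEQ_le_const2[OF lim'] by blast
    then show ?thesis unfolding fock_enorm_infinity[OF True] using c by (auto intro!: SUP_least ennreal_leI)
  next
    case False
    define q where "q = enn2real p"
    have q: "q \<ge> 1" using enn2real_exponent_ge_1[OF p False] by (simp add: q_def)
    have "fint q g = (\<integral>\<^sup>+z. liminf (\<lambda>k. ennreal (wmod (f k) z powr q)) \<partial>lborel)"
      unfolding fint_def
    proof (intro nn_integral_cong)
      fix z
      have "(\<lambda>k. ennreal (wmod (f k) z powr q)) \<longlonglongrightarrow> ennreal (wmod g z powr q)"
        using q by (intro tendsto_intros tendsto_ennrealI tendsto_powr' lim') auto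
      then show "ennreal (wmod g z powr q) = liminf (\<lambda>k. ennreal (wmod (f k) z powr q))"
        by (intro lim_imp_Liminf[symmetric]) auto
    qed
    also have "\<dots> \<le> liminf (\<lambda>k. fint q (f k))"
      unfolding fint_def
    proof (intro nn_integral_liminf)
      fix k
      have [measurable]: "wmod (f k) \<in> borel_measurable borel" by (rule wmod_measurable[OF f])
      show "(\<lambda>z. ennreal (wmod (f k) z powr q)) \<in> borel_measurable lborel" by measurable
    qed
    also have "\<dots> \<le> liminf (\<lambda>k::nat. ennreal (2 * pi / q * c' powr q))"
      using le c fock_enorm_le_iff[OF p False c(2)] by (intro Liminf_mono) (auto simp: q_def)
    also have "\<dots> = ennreal (2 * pi / q * c' powr q)" by (simp add: Liminf_const)
    finally show ?thesis unfolding c(1) fock_enorm_le_iff[OF p False c(2)] by (simp add: q_def)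
  qed
qed simp

lemma fock_enorm_cmult:
  assumes p: "1 \<le> p" and f: "f holomorphic_on UNIV"
  shows "fock_enorm p (\<lambda>z. a * f z) = ennreal (norm a) * fock_enorm p f"
proof (cases "a = 0")
  case False
  have w: "wmod (\<lambda>z. a * f z) z = norm a * wmod f z" for z by (simp add: wmod_def norm_mult)
  show ?thesis
  proof (cases "p = \<infinity>")
    case True
    show ?thesis by (simp add: fock_enorm_infinity[OF True] w ennreal_mult SUP_mult_left_ennreal)
  next
    case F: False
    define q where "q = enn2real p"
    have q: "q \<ge> 1" using enn2real_exponent_ge_1[OF p F] by (simp add: q_def)
    have [measurable]: "wmod f \<in> borel_measurable borel" by (rule wmod_measurable[OF f])
    have "fint q (\<lambda>z. a * f z) = ennreal (norm a powr q) * fint q f"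
      unfolding fint_def w by (subst nn_integral_cmult[symmetric]) (auto simp: powr_mult ennreal_mult)
    then have "fock_enorm p (\<lambda>z. a * f z) =
        epowr (ennreal (norm a powr q) * (ennreal (q / (2 * pi)) * fint q f)) (1 / q)"
      by (simp add: fock_enorm_finite[OF F] q_def mult_ac)
    also have "\<dots> = ennreal (norm a) * fock_enorm p f"
      using False q by (subst epowr_cmult) (auto simp: fock_enorm_finite[OF F] powr_powr q_def)
    finally show ?thesis .
  qed
qed (simp add: fock_enorm_zero)

section \<open>The Fock space\<close>

lemma fock_spaceD: "f \<in> fock_space p \<Longrightarrow> f holomorphic_on UNIV"
  by (simp add: fock_space_def)

lemma fock_norm_nonneg [simp]: "0 \<le> fock_norm p f"
  by (simp add: fock_norm_def)

lemma ennreal_fock_norm: "f \<in> fock_space p \<Longrightarrow> ennreal (fock_norm p f) = fock_enorm p f"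
  by (simp add: fock_space_def fock_norm_def)

lemma fock_spaceI:
  assumes "f holomorphic_on UNIV" "fock_enorm p f \<le> ennreal c"
  shows "f \<in> fock_space p"
  using assms by (auto simp: fock_space_def intro: le_less_trans)

lemma fock_norm_le_iff:
  assumes "f \<in> fock_space p" "c \<ge> 0"
  shows "fock_norm p f \<le> c \<longleftrightarrow> fock_enorm p f \<le> ennreal c"
  using assms by (simp flip: ennreal_fock_norm)

text \<open>The normalised reproducing kernel of F_2. Its weighted modulus is a Gaussian centred at
  w, which keeps its norm bounded in w for every p.\<close>

definition fock_kernel :: "complex \<Rightarrow> complex \<Rightarrow> complex" where
  "fock_kernel w z = exp (cnj w * z - (norm w)\<^sup>2 / 2)"

lemma wmod_fock_kernel: "wmod (fock_kernel w) z = exp (- ((norm (z - w))\<^sup>2 / 2))"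
proof -
  have "wmod (fock_kernel w) z = exp (Re (cnj w * z - (norm w)\<^sup>2 / 2) + - ((norm z)\<^sup>2 / 2))"
    unfolding wmod_def fock_kernel_def norm_exp_eq_Re exp_add ..
  also have "Re (cnj w * z - (norm w)\<^sup>2 / 2) + - ((norm z)\<^sup>2 / 2) = - ((norm (- w + z))\<^sup>2 / 2)"
    unfolding norm_add_power2_complex by (simp add: field_simps flip: of_real_power)
  finally show ?thesis by simp
qed

lemma holomorphic_fock_kernel: "fock_kernel w holomorphic_on UNIV"
  unfolding fock_kernel_def[abs_def] by (intro holomorphic_intros)

lemma higher_deriv_fock_kernel: "(deriv ^^ n) (fock_kernel w) z = cnj w ^ n * fock_kernel w z"
proof (induction n arbitrary: z)
  case (Suc n)
  have "(deriv ^^ n) (fock_kernel w) = (\<lambda>z. cnj w ^ n * fock_kernel w z)" using Suc by blast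
  then have "(deriv ^^ Suc n) (fock_kernel w) z = deriv (\<lambda>z. cnj w ^ n * fock_kernel w z) z" by simp
  also have "\<dots> = cnj w ^ Suc n * fock_kernel w z"
    unfolding fock_kernel_def by (rule DERIV_imp_deriv) (auto intro!: derivative_eq_intros)
  finally show ?case .
qed simp

context
  fixes p :: ennreal
  assumes p: "1 \<le> p"
begin

lemma fock_space_add:
  assumes "f \<in> fock_space p" "g \<in> fock_space p"
  shows "(\<lambda>z. f z + g z) \<in> fock_space p"
    and "fock_norm p (\<lambda>z. f z + g z) \<le> fock_norm p f + fock_norm p g"
proof -
  have le: "fock_enorm p (\<lambda>z. f z + g z) \<le> ennreal (fock_norm p f + fock_norm p g)"
    using assms fock_enorm_triangle[OF fock_spaceD[OF assms(1)] fock_spaceD[OF assms(2)] p]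
    by (simp add: ennreal_fock_norm)
  show *: "(\<lambda>z. f z + g z) \<in> fock_space p"
    by (rule fock_spaceI[OF _ le]) (intro holomorphic_intros fock_spaceD[OF assms(1)] fock_spaceD[OF assms(2)])
  show "fock_norm p (\<lambda>z. f z + g z) \<le> fock_norm p f + fock_norm p g"
    using le by (subst fock_norm_le_iff[OF *]) auto
qed

lemma fock_space_cmult:
  assumes "f \<in> fock_space p"
  shows "(\<lambda>z. a * f z) \<in> fock_space p" and "fock_norm p (\<lambda>z. a * f z) = norm a * fock_norm p f"
  using assms fock_enorm_cmult[OF p fock_spaceD[OF assms], of a]
  by (auto simp: fock_space_def fock_norm_def ennreal_mult_less_top enn2real_mult intro!: holomorphic_intros)

lemma fock_space_diff:
  assumes "f \<in> fock_space p" "g \<in> fock_space p"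
  shows "(\<lambda>z. f z - g z) \<in> fock_space p"
  using fock_space_add(1)[OF assms(1) fock_space_cmult(1)[OF assms(2), of "-1"]] by simp

lemma fock_space_zero: "(\<lambda>z. 0) \<in> fock_space p"
  by (simp add: fock_space_def fock_enorm_zero)

lemma fock_norm_zero: "fock_norm p (\<lambda>z. 0) = 0"
  by (simp add: fock_norm_def fock_enorm_zero)

lemma fock_norm_eq_0_iff:
  assumes "f \<in> fock_space p"
  shows "fock_norm p f = 0 \<longleftrightarrow> f = (\<lambda>z. 0)"
proof
  assume "fock_norm p f = 0"
  then have "fock_enorm p f = 0" using ennreal_fock_norm[OF assms] by simp
  then show "f = (\<lambda>z. 0)" using fock_enorm_eq_0D[OF fock_spaceD[OF assms] p] by blast
qed (simp add: fock_norm_zero)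

lemma wmod_le_fock_norm:
  obtains C where "C > 0" "\<And>f w. f \<in> fock_space p \<Longrightarrow> wmod f w \<le> C * fock_norm p f"
proof -
  obtain C where C: "C > 0" "\<And>f w. f holomorphic_on UNIV \<Longrightarrow> ennreal (wmod f w) \<le> ennreal C * fock_enorm p f"
    using wmod_le_fock_enorm[OF p] by blast
  have "wmod f w \<le> C * fock_norm p f" if "f \<in> fock_space p" for f w
    using C(2)[OF fock_spaceD[OF that], of w] C(1) by (simp flip: ennreal_fock_norm[OF that] ennreal_mult)
  then show thesis using that C(1) by blast
qed

text \<open>\<open>K\<close> is independent of the centre w because area measure is translation
  invariant. The exponent 1/4, half of that in the weight, leaves room for polynomial factors, so
  kernels and monomials are both covered.\<close>

lemma fock_enorm_le_of_gaussian_bound: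
  obtains K where "K > 0" "\<And>f w A. (\<And>z. wmod f z \<le> A * exp (- ((norm (z - w))\<^sup>2 / 4))) \<Longrightarrow> A \<ge> 0 \<Longrightarrow>
    fock_enorm p f \<le> ennreal (A * K)"
proof (cases "p = \<infinity>")
  case True
  show thesis
  proof (rule that[of 1])
    fix f w and A :: real assume le: "\<And>z. wmod f z \<le> A * exp (- ((norm (z - w))\<^sup>2 / 4))" and A: "A \<ge> 0"
    have "wmod f z \<le> A * 1" for z by (rule order_trans[OF le]) (use A in \<open>intro mult_left_mono; simp\<close>)
    then show "fock_enorm p f \<le> ennreal (A * 1)"
      unfolding fock_enorm_infinity[OF True] by (intro SUP_least ennreal_leI)
  qed simp
next
  case False
  define q where "q = enn2real p"
  have q: "q \<ge> 1" using enn2real_exponent_ge_1[OF p False] by (simp add: q_def)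
  define I where "I = (\<integral>\<^sup>+z. ennreal (exp (- (q / 4) * (norm (z::complex))\<^sup>2)) \<partial>lborel)"
  have "I < \<infinity>" unfolding I_def using q by (intro nn_integral_gaussian_finite) auto
  then obtain i where i: "I = ennreal i" "i \<ge> 0" by (cases I) auto
  \<comment> \<open>The summand 1 makes \<open>K\<close> positive without a lower bound for the
    Gaussian integral.\<close>
  define K where "K = (q / (2 * pi) * (i + 1)) powr (1 / q)"
  have K: "K > 0" using q i by (simp add: K_def)
  have Kq: "2 * pi / q * K powr q = i + 1" using q i by (simp add: K_def powr_powr)
  show thesis
  proof (rule that[OF K])
    fix f w and A :: real assume le: "\<And>z. wmod f z \<le> A * exp (- ((norm (z - w))\<^sup>2 / 4))" and A: "A \<ge> 0"
    have "fint q f \<le> (\<integral>\<^sup>+z. ennreal (A powr q) * ennreal (exp (- (q / 4) * (norm (z - w))\<^sup>2)) \<partial>lborel)"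
      unfolding fint_def
    proof (rule nn_integral_mono)
      fix z
      have "wmod f z powr q \<le> (A * exp (- ((norm (z - w))\<^sup>2 / 4))) powr q"
        using q by (intro powr_mono2 le) auto
      also have "\<dots> = A powr q * exp (- (q / 4) * (norm (z - w))\<^sup>2)"
        by (simp add: powr_mult exp_powr_real)
      finally show "ennreal (wmod f z powr q) \<le> ennreal (A powr q) * ennreal (exp (- (q / 4) * (norm (z - w))\<^sup>2))"
        by (simp add: ennreal_leI flip: ennreal_mult)
    qed
    also have "\<dots> = ennreal (A powr q) * (\<integral>\<^sup>+z. ennreal (exp (- (q / 4) * (norm (z - w))\<^sup>2)) \<partial>lborel)"
      by (rule nn_integral_cmult) auto
    also have "(\<integral>\<^sup>+z. ennreal (exp (- (q / 4) * (norm (z - w))\<^sup>2)) \<partial>lborel) = I"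
      unfolding I_def
      using nn_integral_complex_add[of "\<lambda>z. ennreal (exp (- (q / 4) * (norm z)\<^sup>2))" "- w"] by (simp del: minus_mult_minus mult_minus_left)
    also have "ennreal (A powr q) * I \<le> ennreal (A powr q * (i + 1))"
      using i by (simp add: mult_left_mono ennreal_leI flip: ennreal_mult)
    also have "A powr q * (i + 1) = 2 * pi / q * (A * K) powr q"
      using A K by (simp add: powr_mult flip: Kq)
    finally show "fock_enorm p f \<le> ennreal (A * K)"
      using A K by (subst fock_enorm_le_iff[OF p False]) (auto simp: q_def)
  qed
qed

lemma power_mem_fock_space: "(\<lambda>z. z ^ k) \<in> fock_space p"
proof -
  obtain K where K: "K > 0" "\<And>f w A. (\<And>z. wmod f z \<le> A * exp (- ((norm (z - w))\<^sup>2 / 4))) \<Longrightarrow> A \<ge> 0 \<Longrightarrow>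
    fock_enorm p f \<le> ennreal (A * K)"
    using fock_enorm_le_of_gaussian_bound by blast
  have "wmod (\<lambda>z. z ^ k) z \<le> exp ((real k)\<^sup>2) * exp (- ((norm (z - 0))\<^sup>2 / 4))" for z :: complex
  proof -
    define x where "x = norm z"
    have x: "x \<ge> 0" by (simp add: x_def)
    have "x \<le> exp x" using exp_ge_add_one_self[of x] by linarith
    note x = x this
    \<comment> \<open>The bound x^k \<le> exp (k x) reduces the claim to k x - x^2 / 2 \<le> k^2 -
      x^2 / 4, that is, to (x / 2 - k)^2 \<ge> 0.\<close>
    have "x ^ k * exp (- (x\<^sup>2 / 2)) \<le> exp x ^ k * exp (- (x\<^sup>2 / 2))"
      using x by (intro mult_right_mono power_mono) auto
    also have "\<dots> = exp (real k * x - x\<^sup>2 / 2)" by (simp add: exp_of_nat_mult[symmetric] flip: exp_add)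
    also have "\<dots> \<le> exp ((real k)\<^sup>2 + - (x\<^sup>2 / 4))"
    proof -
      have "0 \<le> (x / 2 - real k)\<^sup>2" by simp
      then have "real k * x - x\<^sup>2 / 2 \<le> (real k)\<^sup>2 + - (x\<^sup>2 / 4)" by (simp add: power2_diff field_simps)
      then show ?thesis by simp
    qed
    also have "\<dots> = exp ((real k)\<^sup>2) * exp (- (x\<^sup>2 / 4))" by (rule exp_add)
    finally show ?thesis by (simp add: wmod_def norm_power x_def)
  qed
  from K(2)[OF this] show ?thesis by (intro fock_spaceI) (auto intro!: holomorphic_intros)
qed

lemma fock_kernel_bounded:
  obtains K where "K > 0" "\<And>w. fock_kernel w \<in> fock_space p \<and> fock_norm p (fock_kernel w) \<le> K"
proof -
  obtain K where K: "K > 0" "\<And>f w A. (\<And>z. wmod f z \<le> A * exp (- ((norm (z - w))\<^sup>2 / 4))) \<Longrightarrow> A \<ge> 0 \<Longrightarrow>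
    fock_enorm p f \<le> ennreal (A * K)"
    using fock_enorm_le_of_gaussian_bound by blast
  have "fock_enorm p (fock_kernel w) \<le> ennreal (1 * K)" for w
    by (rule K(2)[of _ _ w]) (auto simp: wmod_fock_kernel)
  then have "fock_enorm p (fock_kernel w) \<le> ennreal K" for w by simp
  moreover from this have "fock_kernel w \<in> fock_space p" for w
    by (rule fock_spaceI[OF holomorphic_fock_kernel])
  ultimately show thesis
    using that[of K] K(1) fock_norm_le_iff[of _ p K] by auto
qed

section \<open>Compactness and completeness\<close>

text \<open>A norm bound is a uniform bound on every compact set, which is what Montel's theorem
  requires. The convergence is locally uniform and need not hold in norm, but it passes to all
  derivatives, and applying the operator pointwise needs no more.\<close>

lemma fock_bounded_sequence_converges:
  assumes f: "\<And>k. f k \<in> fock_space p" and c: "\<And>k. fock_norm p (f k) \<le> c"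
  obtains g r where "strict_mono (r :: nat \<Rightarrow> nat)" "g \<in> fock_space p" "fock_norm p g \<le> c"
    "\<And>m z. (\<lambda>k. (deriv ^^ m) (f (r k)) z) \<longlonglongrightarrow> (deriv ^^ m) g z"
proof -
  have c0: "c \<ge> 0" using order_trans[OF fock_norm_nonneg c] .
  obtain C where C: "C > 0" "\<And>f w. f \<in> fock_space p \<Longrightarrow> wmod f w \<le> C * fock_norm p f"
    using wmod_le_fock_norm by blast
  have bnd: "\<exists>B. \<forall>h\<in>range f. \<forall>z\<in>K. norm (h z) \<le> B" if K: "compact K" "K \<subseteq> UNIV" for K
  proof -
    obtain R where R: "\<And>z. z \<in> K \<Longrightarrow> norm z \<le> R" using compact_imp_bounded[OF K(1)] by (auto simp: bounded_iff)
    have "norm (f k z) \<le> C * c * exp (R\<^sup>2 / 2)" if "z \<in> K" for k z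
    proof -
      have "norm (f k z) = wmod (f k) z * exp ((norm z)\<^sup>2 / 2)"
        by (simp add: wmod_def mult.assoc flip: exp_add)
      also have "\<dots> \<le> (C * c) * exp (R\<^sup>2 / 2)"
        using C(1) c0 power_mono[OF R[OF that], of 2]
        by (intro mult_mono order_trans[OF C(2)[OF f] mult_left_mono[OF c]]) auto
      finally show ?thesis .
    qed
    then show ?thesis by blast
  qed
  have hol: "\<And>h. h \<in> range f \<Longrightarrow> h holomorphic_on UNIV" using fock_spaceD[OF f] by auto
  obtain g r where gr: "g holomorphic_on UNIV" "strict_mono (r :: nat \<Rightarrow> nat)"
      "\<And>x. x \<in> UNIV \<Longrightarrow> (\<lambda>n. f (r n) x) \<longlonglongrightarrow> g x"
      "\<And>K. compact K \<Longrightarrow> K \<subseteq> UNIV \<Longrightarrow> uniform_limit K (f \<circ> r) g sequentially"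
    by (rule Montel[OF open_UNIV hol bnd order_refl]) blast+
  have enorm: "fock_enorm p g \<le> ennreal c"
    by (rule fock_enorm_le_of_tendsto[OF p, of "\<lambda>k. f (r k)"])
      (use f fock_spaceD gr(3) c fock_norm_le_iff[OF f c0] in auto)
  have g: "g \<in> fock_space p" by (rule fock_spaceI[OF gr(1) enorm])
  show thesis
  proof (rule that[OF gr(2) g])
    show "fock_norm p g \<le> c" using fock_norm_le_iff[OF g c0] enorm by simp
    show "(\<lambda>k. (deriv ^^ m) (f (r k)) z) \<longlonglongrightarrow> (deriv ^^ m) g z" for m z
    proof (rule higher_deriv_complex_uniform_limit[where A = "ball z 1"])
      have "uniform_limit (cball z 1) (f \<circ> r) g sequentially" by (rule gr(4)) auto
      then show "uniform_limit (ball z 1) (\<lambda>k. f (r k)) g sequentially"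
        by (auto simp: o_def intro: uniform_limit_on_subset)
      show "\<forall>\<^sub>F k in sequentially. f (r k) holomorphic_on ball z 1"
        by (intro always_eventually allI holomorphic_on_subset[OF fock_spaceD[OF f]]) auto
    qed auto
  qed
qed

lemma mcomplete_fock: "Metric_space.mcomplete (fock_space p) (fock_dist p)"
proof -
  interpret Metric_space "fock_space p" "fock_dist p" by (rule Metric_space_fock[OF p])
  show ?thesis unfolding mcomplete_def
  proof (intro allI impI)
    fix \<sigma> assume "MCauchy \<sigma>"
    then have \<sigma>: "\<And>k. \<sigma> k \<in> fock_space p"
      and cau: "\<And>\<epsilon>. \<epsilon> > 0 \<Longrightarrow> \<exists>N. \<forall>n n'. N \<le> n \<longrightarrow> N \<le> n' \<longrightarrow> fock_dist p (\<sigma> n) (\<sigma> n') < \<epsilon>"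
      by (auto simp: MCauchy_def)
    obtain N where N: "\<And>n n'. N \<le> n \<Longrightarrow> N \<le> n' \<Longrightarrow> fock_dist p (\<sigma> n) (\<sigma> n') < 1"
      using cau[of 1] by auto
    have bnd: "fock_norm p (\<sigma> (k + N)) \<le> fock_norm p (\<sigma> N) + 1" for k
      using fock_space_add(2)[OF fock_space_diff[OF \<sigma> \<sigma>] \<sigma>, of "k + N" N N] N[of "k + N" N]
      by (simp add: fock_dist_def)
    obtain g r where gr: "strict_mono (r :: nat \<Rightarrow> nat)" "g \<in> fock_space p"
        "\<And>m z. (\<lambda>k. (deriv ^^ m) (\<sigma> (r k + N)) z) \<longlonglongrightarrow> (deriv ^^ m) g z"
      by (rule fock_bounded_sequence_converges[of "\<lambda>k. \<sigma> (k + N)", OF \<sigma> bnd]) blast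
    have lim: "(\<lambda>k. \<sigma> (r k + N) z) \<longlonglongrightarrow> g z" for z using gr(3)[of 0] by simp
    have "limitin mtopology \<sigma> g sequentially"
      unfolding limit_metric_sequentially
    proof (intro conjI allI impI gr(2))
      fix \<epsilon> :: real assume \<epsilon>: "\<epsilon> > 0"
      obtain M where M: "\<And>n n'. M \<le> n \<Longrightarrow> M \<le> n' \<Longrightarrow> fock_dist p (\<sigma> n) (\<sigma> n') < \<epsilon> / 2"
        using cau[of "\<epsilon> / 2"] \<epsilon> by auto
      have "fock_dist p (\<sigma> m) g < \<epsilon>" if m: "m \<ge> M" for m
      proof -
        \<comment> \<open>Shifting the subsequence by \<open>M\<close> puts all its indices beyond
          \<open>M\<close>, so the Cauchy estimate holds for every k and survives the pointwise
          limit by semicontinuity.\<close>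
        have "fock_enorm p (\<lambda>z. \<sigma> m z - g z) \<le> ennreal (\<epsilon> / 2)"
        proof (rule fock_enorm_le_of_tendsto[OF p, of "\<lambda>k z. \<sigma> m z - \<sigma> (r (k + M) + N) z"])
          show "(\<lambda>z. \<sigma> m z - \<sigma> (r (k + M) + N) z) holomorphic_on UNIV" for k
            by (intro holomorphic_intros fock_spaceD[OF \<sigma>])
          have "M \<le> r (k + M)" for k using seq_suble[OF gr(1), of "k + M"] by simp
          then have "fock_dist p (\<sigma> m) (\<sigma> (r (k + M) + N)) < \<epsilon> / 2" for k using m by (intro M) (auto intro: trans_le_add1)
          then show "fock_enorm p (\<lambda>z. \<sigma> m z - \<sigma> (r (k + M) + N) z) \<le> ennreal (\<epsilon> / 2)" for k
            using fock_norm_le_iff[OF fock_space_diff[OF \<sigma>[of m] \<sigma>[of "r (k + M) + N"]], of "\<epsilon> / 2"] \<epsilon>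
            by (simp add: fock_dist_def less_imp_le)
          show "(\<lambda>k. \<sigma> m z - \<sigma> (r (k + M) + N) z) \<longlonglongrightarrow> \<sigma> m z - g z" for z
            using LIMSEQ_ignore_initial_segment[OF lim[of z], of M] by (intro tendsto_intros)
        qed
        then have "fock_norm p (\<lambda>z. \<sigma> m z - g z) \<le> \<epsilon> / 2"
          using fock_norm_le_iff[OF fock_space_diff[OF \<sigma>[of m] gr(2)], of "\<epsilon> / 2"] \<epsilon> by simp
        then show ?thesis using \<epsilon> by (simp add: fock_dist_def)
      qed
      then show "\<exists>N. \<forall>n\<ge>N. \<sigma> n \<in> fock_space p \<and> fock_dist p (\<sigma> n) g < \<epsilon>" using \<sigma> by blast
    qed
    then show "\<exists>x. limitin mtopology \<sigma> x sequentially" by blast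
  qed
qed

text \<open>The Taylor polynomial of degree below n at 0 is removed one monomial per induction step.
  Monomials lie in every Fock space, and subtracting a multiple of z^n does not affect derivatives
  of order n + 1.\<close>

lemma ex_fock_space0_same_deriv:
  assumes "f \<in> fock_space p"
  obtains g where "g \<in> fock_space0 p n" "(deriv ^^ n) g = (deriv ^^ n) f"
proof -
  have "\<exists>g\<in>fock_space0 p n. (deriv ^^ n) g = (deriv ^^ n) f"
  proof (induction n)
    case 0
    show ?case using assms by (auto simp: fock_space0_def)
  next
    case (Suc n)
    then obtain g where g: "g \<in> fock_space p" "\<And>j. j < n \<Longrightarrow> (deriv ^^ j) g 0 = 0" "(deriv ^^ n) g = (deriv ^^ n) f"
      by (auto simp: fock_space0_def)
    define a where "a = (deriv ^^ n) g 0 / fact n"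
    \<comment> \<open>For j \<le> n the rising factorial is n! / (n - j)!; at j = n + 1 it starts at
      0 and therefore vanishes.\<close>
    have mono: "(deriv ^^ j) (\<lambda>z. a * z ^ n) z = a * (pochhammer (of_nat (Suc n - j)) j * z ^ (n - j))" for j and z :: complex
      using higher_deriv_power[of j 0 n z]
      by (subst higher_deriv_cmult[of _ UNIV]) (auto intro!: holomorphic_intros)
    define h where "h z = g z - a * z ^ n" for z
    have h: "h \<in> fock_space p"
      unfolding h_def by (intro fock_space_diff g fock_space_cmult power_mem_fock_space)
    have dh: "(deriv ^^ j) h z = (deriv ^^ j) g z - (deriv ^^ j) (\<lambda>z. a * z ^ n) z" for j z
      unfolding h_def by (rule higher_deriv_diff[of _ UNIV]) (intro holomorphic_intros fock_spaceD[OF g(1)] open_UNIV UNIV_I)+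
    have "(deriv ^^ j) h 0 = 0" if "j < Suc n" for j
    proof (cases "j = n")
      case True
      then show ?thesis unfolding dh mono by (simp add: pochhammer_fact[symmetric]) (simp add: a_def)
    next
      case False
      then show ?thesis using that by (simp add: dh mono g)
    qed
    moreover have "(deriv ^^ Suc n) h = (deriv ^^ Suc n) f"
    proof -
      have "(deriv ^^ Suc n) (\<lambda>z. a * z ^ n) z = 0" for z by (subst mono) (simp add: pochhammer_0_left)
      then have "(deriv ^^ Suc n) h z = (deriv ^^ Suc n) g z" for z unfolding dh by simp
      then show ?thesis using g(3) by (simp add: fun_eq_iff)
    qed
    ultimately show ?case using h by (auto simp: fock_space0_def)
  qed
  then show thesis using that by blast
qed

end

section \<open>Closed range and boundedness below\<close>

lemma wcd_op_diff:
  assumes "f holomorphic_on UNIV" "g holomorphic_on UNIV"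
  shows "wcd_op u \<psi> n (\<lambda>z. f z - g z) = (\<lambda>z. wcd_op u \<psi> n f z - wcd_op u \<psi> n g z)"
  using higher_deriv_diff[OF assms open_UNIV UNIV_I] by (simp add: wcd_op_def right_diff_distrib)

lemma wcd_op_add:
  assumes "f holomorphic_on UNIV" "g holomorphic_on UNIV"
  shows "wcd_op u \<psi> n (\<lambda>z. f z + g z) = (\<lambda>z. wcd_op u \<psi> n f z + wcd_op u \<psi> n g z)"
  using higher_deriv_add[OF assms open_UNIV UNIV_I] by (simp add: wcd_op_def distrib_left)

lemma wcd_op_cmult:
  assumes "f holomorphic_on UNIV"
  shows "wcd_op u \<psi> n (\<lambda>z. a * f z) = (\<lambda>z. a * wcd_op u \<psi> n f z)"
  using higher_deriv_cmult[OF assms UNIV_I open_UNIV] by (simp add: wcd_op_def mult_ac)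

lemma fock_space0D: "f \<in> fock_space0 p n \<Longrightarrow> f \<in> fock_space p"
  by (simp add: fock_space0_def)

lemma fock_space0_add:
  assumes "1 \<le> p" "f \<in> fock_space0 p n" "g \<in> fock_space0 p n"
  shows "(\<lambda>z. f z + g z) \<in> fock_space0 p n"
  using assms fock_space_add(1)[of p f g] higher_deriv_add[of f UNIV g 0]
  by (auto simp: fock_space0_def fock_spaceD)

lemma fock_space0_diff:
  assumes "1 \<le> p" "f \<in> fock_space0 p n" "g \<in> fock_space0 p n"
  shows "(\<lambda>z. f z - g z) \<in> fock_space0 p n"
  using assms fock_space_diff[of p f g] higher_deriv_diff[of f UNIV g 0]
  by (auto simp: fock_space0_def fock_spaceD)

lemma fock_space0_cmult:
  assumes "1 \<le> p" "f \<in> fock_space0 p n"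
  shows "(\<lambda>z. a * f z) \<in> fock_space0 p n"
  using assms fock_space_cmult(1)[of p f a] higher_deriv_cmult[of f UNIV 0]
  by (auto simp: fock_space0_def fock_spaceD)

text \<open>\<open>\<psi>\<close> maps the open set where u does not vanish onto an open set, on
  which the n-th derivative of f is then zero, so it is zero everywhere. The Taylor coefficients
  below n vanish by membership in the subspace, those from n on by this.\<close>

lemma wcd_op_eq_0D:
  assumes u: "u holomorphic_on UNIV" "u z0 \<noteq> 0" and \<psi>: "\<psi> holomorphic_on UNIV" "\<not> \<psi> constant_on UNIV"
    and f: "f \<in> fock_space0 p n" and zero: "wcd_op u \<psi> n f = (\<lambda>z. 0)"
  shows "f = (\<lambda>z. 0)"
proof -
  have hf: "f holomorphic_on UNIV" using fock_spaceD[OF fock_space0D[OF f]] .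
  define U where "U = {z. u z \<noteq> 0}"
  have U: "open U" "z0 \<in> U"
    unfolding U_def using u by (auto intro!: open_Collect_neq entire_continuous_on)
  have "open (\<psi> ` U)"
    by (rule open_mapping_thm[OF \<psi>(1) open_UNIV connected_UNIV U(1) subset_UNIV \<psi>(2)])
  moreover have "(deriv ^^ n) f w = 0" if "w \<in> \<psi> ` U" for w
    using that fun_cong[OF zero] by (auto simp: wcd_op_def U_def)
  ultimately have dn: "(deriv ^^ n) f w = 0" for w
    using analytic_continuation_open[of "\<psi> ` U" UNIV "(deriv ^^ n) f" "\<lambda>_. 0" w]
      entire_higher_deriv[OF hf] U(2) by auto
  have "(deriv ^^ j) f 0 = 0" for j
  proof (cases "j < n")
    case True
    then show ?thesis using f by (simp add: fock_space0_def)
  next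
    case False
    have "(deriv ^^ (i + n)) f = (\<lambda>w. 0)" for i
    proof -
      have "(deriv ^^ n) f = (\<lambda>w. 0)" using dn by blast
      then have "(deriv ^^ (i + n)) f = (deriv ^^ i) (\<lambda>w. 0)" by (simp only: funpow_add o_def)
      then show ?thesis by simp
    qed
    from this[of "j - n"] show ?thesis using False by simp
  qed
  then have "f w = 0" for w
    using holomorphic_fun_eq_0_on_connected[OF hf open_UNIV connected_UNIV, of 0 w] by simp
  then show ?thesis by blast
qed

lemma tendsto_of_limitin_fock:
  assumes p: "1 \<le> p" and lim: "limitin (fock_topology p) \<sigma> l sequentially" and \<sigma>: "range \<sigma> \<subseteq> fock_space p"
  shows "(\<lambda>k. \<sigma> k z) \<longlonglongrightarrow> l z"
proof -
  interpret Metric_space "fock_space p" "fock_dist p" by (rule Metric_space_fock[OF p])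
  have l: "l \<in> fock_space p"
    using lim unfolding fock_topology_def by (rule limitin_mspace)
  obtain C where C: "C > 0" "\<And>f w. f \<in> fock_space p \<Longrightarrow> wmod f w \<le> C * fock_norm p f"
    using wmod_le_fock_norm[OF p] by blast
  have le: "norm (\<sigma> k z - l z) \<le> C * exp ((norm z)\<^sup>2 / 2) * fock_dist p (\<sigma> k) l" for k
  proof -
    have "norm (\<sigma> k z - l z) = wmod (\<lambda>z. \<sigma> k z - l z) z * exp ((norm z)\<^sup>2 / 2)"
      by (simp add: wmod_def mult.assoc flip: exp_add)
    also have "\<dots> \<le> C * fock_dist p (\<sigma> k) l * exp ((norm z)\<^sup>2 / 2)"
      unfolding fock_dist_def using C(2)[OF fock_space_diff[OF p, of "\<sigma> k" l]] l \<sigma> by (intro mult_right_mono) auto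
    finally show ?thesis by (simp add: mult_ac)
  qed
  have "(\<lambda>k. fock_dist p (\<sigma> k) l) \<longlonglongrightarrow> 0"
    using lim unfolding fock_topology_def limitin_metric_dist_null by blast
  then have "(\<lambda>k. C * exp ((norm z)\<^sup>2 / 2) * fock_dist p (\<sigma> k) l) \<longlonglongrightarrow> 0"
    by (rule tendsto_mult_right_zero)
  then have "(\<lambda>k. \<sigma> k z - l z) \<longlonglongrightarrow> 0"
    by (rule Lim_null_comparison[rotated]) (use le in auto)
  then show ?thesis using LIM_zero_iff by blast
qed

text \<open>The preimages converge only along a subsequence, but their images already converge to h.
  That the bound c survives is essential: it makes the image of each single ball closed, not just
  their union.\<close>

lemma wcd_op_image_closed:
  assumes p: "1 \<le> p" and f: "\<And>k. f k \<in> fock_space0 p n" "\<And>k. fock_norm p (f k) \<le> c"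
    and lim: "\<And>z. (\<lambda>k. wcd_op u \<psi> n (f k) z) \<longlonglongrightarrow> h z"
  obtains g where "g \<in> fock_space0 p n" "fock_norm p g \<le> c" "wcd_op u \<psi> n g = h"
proof -
  obtain g r where gr: "strict_mono (r :: nat \<Rightarrow> nat)" "g \<in> fock_space p" "fock_norm p g \<le> c"
    "\<And>m z. (\<lambda>k. (deriv ^^ m) (f (r k)) z) \<longlonglongrightarrow> (deriv ^^ m) g z"
    by (rule fock_bounded_sequence_converges[OF p, of f c, OF fock_space0D[OF f(1)] f(2)]) blast
  have "(deriv ^^ j) g 0 = 0" if "j < n" for j
  proof -
    have "(\<lambda>k. (deriv ^^ j) (f (r k)) 0) = (\<lambda>k. 0)" using f(1) that by (auto simp: fock_space0_def)
    then show ?thesis using gr(4)[of j 0] LIMSEQ_unique tendsto_const by metis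
  qed
  then have g: "g \<in> fock_space0 p n" using gr(2) by (simp add: fock_space0_def)
  have "wcd_op u \<psi> n g z = h z" for z
  proof (rule LIMSEQ_unique)
    show "(\<lambda>k. wcd_op u \<psi> n (f (r k)) z) \<longlonglongrightarrow> wcd_op u \<psi> n g z"
      unfolding wcd_op_def by (intro tendsto_intros gr)
    show "(\<lambda>k. wcd_op u \<psi> n (f (r k)) z) \<longlonglongrightarrow> h z"
      using LIMSEQ_subseq_LIMSEQ[OF lim gr(1)] by (simp add: o_def)
  qed
  then show thesis using that g gr(3) by blast
qed

lemma wcd_op_image_fock_space0:
  assumes "1 \<le> p"
  shows "wcd_op u \<psi> n ` fock_space p = wcd_op u \<psi> n ` fock_space0 p n"
proof
  show "wcd_op u \<psi> n ` fock_space0 p n \<subseteq> wcd_op u \<psi> n ` fock_space p" by (auto dest: fock_space0D)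
  show "wcd_op u \<psi> n ` fock_space p \<subseteq> wcd_op u \<psi> n ` fock_space0 p n"
  proof
    fix h assume "h \<in> wcd_op u \<psi> n ` fock_space p"
    then obtain f where f: "f \<in> fock_space p" "h = wcd_op u \<psi> n f" by blast
    obtain g where "g \<in> fock_space0 p n" "(deriv ^^ n) g = (deriv ^^ n) f"
      using ex_fock_space0_same_deriv[OF assms f(1)] by blast
    then show "h \<in> wcd_op u \<psi> n ` fock_space0 p n" using f(2) by (auto simp: wcd_op_def intro!: image_eqI[of _ _ g])
  qed
qed

lemma closed_range_iff_bounded_below:
  assumes u: "u holomorphic_on UNIV" "\<exists>z. u z \<noteq> 0"
    and \<psi>: "\<psi> holomorphic_on UNIV" "\<not> \<psi> constant_on UNIV"
    and p: "1 \<le> p" and bdd: "bounded_on_fock p (wcd_op u \<psi> n)"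
  shows "closed_range_on_fock p (wcd_op u \<psi> n) \<longleftrightarrow>
    (\<exists>c>0. \<forall>f\<in>fock_space0 p n. c * fock_norm p f \<le> fock_norm p (wcd_op u \<psi> n f))"
proof -
  interpret Metric_space "fock_space p" "fock_dist p" by (rule Metric_space_fock[OF p])
  define T where "T = wcd_op u \<psi> n"
  define R where "R = T ` fock_space0 p n"
  have R: "R = T ` fock_space p" unfolding R_def T_def by (rule wcd_op_image_fock_space0[OF p, symmetric])
  have TF: "T f \<in> fock_space p" if "f \<in> fock_space p" for f
    using bdd that by (auto simp: bounded_on_fock_def T_def)
  have RF: "R \<subseteq> fock_space p" unfolding R using TF by blast
  have top: "fock_topology p = mtopology" by (simp add: fock_topology_def)
  show ?thesis
  proof
    assume "\<exists>c>0. \<forall>f\<in>fock_space0 p n. c * fock_norm p f \<le> fock_norm p (wcd_op u \<psi> n f)"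
    then obtain c where c: "c > 0" "\<And>f. f \<in> fock_space0 p n \<Longrightarrow> c * fock_norm p f \<le> fock_norm p (T f)"
      by (auto simp: T_def)
    have "l \<in> R" if \<sigma>: "range \<sigma> \<subseteq> R" and lim: "limitin mtopology \<sigma> l sequentially" for \<sigma> l
    proof -
      have l: "l \<in> fock_space p" using lim by (rule limitin_mspace)
      have \<sigma>F: "\<sigma> k \<in> fock_space p" for k using \<sigma> RF by blast
      have "\<exists>f\<in>fock_space0 p n. T f = \<sigma> k" for k
      proof -
        have "\<sigma> k \<in> R" using \<sigma> by blast
        then show ?thesis by (auto simp: R_def)
      qed
      then obtain f where f: "\<And>k. f k \<in> fock_space0 p n" "\<And>k. T (f k) = \<sigma> k" by metis
      obtain N where N: "\<And>k. k \<ge> N \<Longrightarrow> fock_dist p (\<sigma> k) l < 1"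
        using lim unfolding limit_metric_sequentially by (meson zero_less_one)
      have bnd: "fock_norm p (f (k + N)) \<le> (fock_norm p l + 1) / c" for k
      proof -
        have "c * fock_norm p (f (k + N)) \<le> fock_norm p (\<sigma> (k + N))" using c(2)[OF f(1)] f(2) by metis
        also have "\<dots> \<le> fock_norm p l + 1"
          using fock_space_add(2)[OF p fock_space_diff[OF p \<sigma>F l] l, of "k + N"] N[of "k + N"]
          by (simp add: fock_dist_def)
        finally show ?thesis using c(1) by (simp add: field_simps)
      qed
      have "(\<lambda>k. wcd_op u \<psi> n (f (k + N)) z) \<longlonglongrightarrow> l z" for z
      proof -
        have "(\<lambda>k. \<sigma> k z) \<longlonglongrightarrow> l z"
          by (rule tendsto_of_limitin_fock[OF p]) (use lim \<sigma>F top in auto)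
        from LIMSEQ_ignore_initial_segment[OF this, of N] show ?thesis by (simp add: f(2) flip: T_def)
      qed
      then obtain g where "g \<in> fock_space0 p n" "wcd_op u \<psi> n g = l"
        by (rule wcd_op_image_closed[OF p f(1) bnd])
      then show ?thesis by (auto simp: R_def T_def)
    qed
    then have "closedin mtopology R" unfolding metric_closedin_iff_sequentially_closed using RF by blast
    then show "closed_range_on_fock p (wcd_op u \<psi> n)"
      by (simp add: closed_range_on_fock_def top R T_def)
  next
    assume "closed_range_on_fock p (wcd_op u \<psi> n)"
    then have clo: "closedin mtopology R" by (simp add: closed_range_on_fock_def top R T_def)
    \<comment> \<open>Interiors are taken relative to \<open>R\<close>, which is a complete metric
      space of its own, being closed in a complete one.\<close>
    interpret Submetric "fock_space p" "fock_dist p" R by unfold_locales (rule RF)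
    have comp: "sub.mcomplete" by (rule closedin_mcomplete_imp_mcomplete[OF clo mcomplete_fock[OF p]])
    define B where "B k = {f \<in> fock_space0 p n. fock_norm p f \<le> real k}" for k :: nat
    have inj: "f = g" if "f \<in> fock_space0 p n" "g \<in> fock_space0 p n" "T f = T g" for f g
    proof -
      have "T (\<lambda>z. f z - g z) = (\<lambda>z. 0)"
        using that unfolding T_def by (subst wcd_op_diff) (auto dest: fock_space0D fock_spaceD)
      then have "(\<lambda>z. f z - g z) = (\<lambda>z. 0)"
        using wcd_op_eq_0D[OF u(1) _ \<psi> fock_space0_diff[OF p that(1,2)]] u(2) by (auto simp: T_def)
      then show ?thesis by (simp add: fun_eq_iff)
    qed
    have zero: "(\<lambda>z. 0) \<in> fock_space0 p n" using fock_space_zero[OF p] by (auto simp: fock_space0_def)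
    have cl: "closedin sub.mtopology (T ` B k)" for k
      unfolding sub.metric_closedin_iff_sequentially_closed
    proof (intro conjI allI impI)
      show "T ` B k \<subseteq> R" by (auto simp: B_def R_def)
      fix \<sigma> l assume as: "range \<sigma> \<subseteq> T ` B k \<and> limitin sub.mtopology \<sigma> l sequentially"
      then have \<sigma>: "\<sigma> j \<in> T ` B k" for j by blast
      have "\<exists>f\<in>B k. T f = \<sigma> j" for j using \<sigma>[of j] by auto
      then obtain f where f: "\<And>j. f j \<in> B k" "\<And>j. T (f j) = \<sigma> j" by metis
      have lim: "limitin mtopology \<sigma> l sequentially" using as limitin_submetric_iff by blast
      have "\<sigma> j \<in> fock_space p" for j using f TF by (metis (lifting) B_def fock_space0D mem_Collect_eq)
      then have "(\<lambda>j. \<sigma> j z) \<longlonglongrightarrow> l z" for z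
        using tendsto_of_limitin_fock[OF p] lim top by (metis image_subset_iff)
      then have "(\<lambda>j. wcd_op u \<psi> n (f j) z) \<longlonglongrightarrow> l z" for z by (simp add: f(2) flip: T_def)
      moreover have "f j \<in> fock_space0 p n" "fock_norm p (f j) \<le> real k" for j using f(1)[of j] by (auto simp: B_def)
      ultimately obtain g where "g \<in> fock_space0 p n" "fock_norm p g \<le> real k" "wcd_op u \<psi> n g = l"
        using wcd_op_image_closed[OF p, of f n "real k" u \<psi> l] by blast
      then show "l \<in> T ` B k" by (auto simp: B_def T_def)
    qed
    \<comment> \<open>Otherwise the union of the images of the \<open>B k\<close> would have empty
      interior; but this union is all of \<open>R\<close>, which is open in itself and contains the
      image of 0.\<close>
    have "\<exists>k. sub.mtopology interior_of (T ` B k) \<noteq> {}"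
    proof (rule ccontr)
      assume "\<nexists>k. sub.mtopology interior_of (T ` B k) \<noteq> {}"
      then have "sub.mtopology interior_of \<Union> (range (\<lambda>k. T ` B k)) = {}"
        using cl by (intro sub.metric_Baire_category_alt[OF comp]) auto
      moreover have "\<Union> (range (\<lambda>k. T ` B k)) = R"
        unfolding R_def B_def using real_arch_simple by fastforce
      moreover have "sub.mtopology interior_of R = R"
        using sub.topspace_mtopology by (metis interior_of_topspace)
      ultimately show False using zero by (auto simp: R_def)
    qed
    then obtain k h0 where "h0 \<in> sub.mtopology interior_of (T ` B k)" by blast
    then obtain U where U: "openin sub.mtopology U" "h0 \<in> U" "U \<subseteq> T ` B k"
      by (auto simp: interior_of_def)
    then obtain r where r: "r > 0" "sub.mball h0 r \<subseteq> T ` B k"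
      unfolding sub.openin_mtopology by (meson subset_trans)
    obtain f0 where f0: "f0 \<in> fock_space0 p n" "fock_norm p f0 \<le> real k" "h0 = T f0"
      using U by (auto simp: B_def)
    \<comment> \<open>A small image moves \<open>h0\<close> within the ball inside the image of
      \<open>B k\<close>. Injectivity then identifies \<open>f0 + f\<close> with an element of
      \<open>B k\<close>, and subtracting \<open>f0\<close> at most doubles the bound.\<close>
    have small: "fock_norm p f \<le> 2 * real k" if f: "f \<in> fock_space0 p n" "fock_norm p (T f) < r" for f
    proof -
      have F: "f \<in> fock_space p" "f0 \<in> fock_space p" using f(1) f0(1) by (auto dest: fock_space0D)
      define g where "g z = f0 z + f z" for z
      have g: "g \<in> fock_space0 p n" unfolding g_def by (rule fock_space0_add[OF p f0(1) f(1)])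
      have Tg: "T g = (\<lambda>z. T f0 z + T f z)"
        unfolding g_def T_def by (rule wcd_op_add) (use F fock_spaceD in auto)
      have "fock_dist p h0 (T g) = fock_norm p (\<lambda>z. - T f z)" by (simp add: fock_dist_def Tg f0(3))
      also have "\<dots> = fock_norm p (T f)" by (simp add: fock_norm_def fock_enorm_uminus)
      finally have "T g \<in> sub.mball h0 r"
        unfolding sub.in_mball using f(2) f0(1,3) g by (auto simp: R_def)
      then obtain b where b: "b \<in> B k" "T g = T b" using r(2) by blast
      then have "g = b" using inj[OF g] by (auto simp: B_def)
      then have gk: "fock_norm p g \<le> real k" using b by (auto simp: B_def)
      have "f = (\<lambda>z. g z + - 1 * f0 z)" by (simp add: g_def)
      then have "fock_norm p f \<le> fock_norm p g + fock_norm p (\<lambda>z. - 1 * f0 z)"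
        using fock_space_add(2)[OF p fock_space0D[OF g] fock_space_cmult(1)[OF p F(2), of "- 1"]] by metis
      also have "\<dots> \<le> real k + real k"
        using gk f0(2) fock_space_cmult(2)[OF p F(2), of "- 1"] by simp
      finally show ?thesis by simp
    qed
    \<comment> \<open>Scaling f so that its image has norm r / 2 gives r * |f| \<le> 4 k * |T f| in
      norms; the summand 1 guards against k = 0.\<close>
    define c where "c = r / (4 * real k + 1)"
    have c: "c > 0" using r(1) by (simp add: c_def add_nonneg_pos)
    have "c * fock_norm p f \<le> fock_norm p (T f)" if f: "f \<in> fock_space0 p n" for f
    proof (cases "fock_norm p (T f) = 0")
      case True
      then have "T f = (\<lambda>z. 0)" using fock_norm_eq_0_iff[OF p TF[OF fock_space0D[OF f]]] by simp
      then have "f = (\<lambda>z. 0)" using wcd_op_eq_0D[OF u(1) _ \<psi> f] u(2) by (auto simp: T_def)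
      then show ?thesis by (simp add: fock_norm_zero[OF p])
    next
      case False
      define m where "m = fock_norm p (T f)"
      have m: "m > 0" using False by (simp add: m_def order_less_le)
      define t where "t = r / (2 * m)"
      have t: "t > 0" using m r(1) by (simp add: t_def)
      have F: "f \<in> fock_space p" using f by (rule fock_space0D)
      have "fock_norm p (T (\<lambda>z. of_real t * f z)) = fock_norm p (\<lambda>z. of_real t * T f z)"
        unfolding T_def by (subst wcd_op_cmult[OF fock_spaceD[OF F]]) simp
      also have "\<dots> = t * m" using t fock_space_cmult(2)[OF p TF[OF F], of "of_real t"] by (simp add: m_def)
      also have "\<dots> < r" using m r(1) by (simp add: t_def)
      finally have "fock_norm p (\<lambda>z. of_real t * f z) \<le> 2 * real k"
        by (rule small[OF fock_space0_cmult[OF p f]])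
      then have "t * fock_norm p f \<le> 2 * real k"
        using t fock_space_cmult(2)[OF p F, of "of_real t"] by simp
      then have "r * fock_norm p f \<le> (4 * real k) * m" using m by (simp add: t_def field_simps)
      also have "\<dots> \<le> (4 * real k + 1) * m" using m by (simp add: algebra_simps)
      finally show ?thesis unfolding m_def[symmetric] c_def by (simp add: field_simps add_nonneg_pos)
    qed
    then show "\<exists>c>0. \<forall>f\<in>fock_space0 p n. c * fock_norm p f \<le> fock_norm p (wcd_op u \<psi> n f)"
      using c by (auto simp: T_def)
  qed
qed

section \<open>Bounded operators have affine symbols\<close>

text \<open>Used twice, it gives the Taylor expansion to second order with an entire remainder
  factor.\<close>

lemma entire_factor_linear:
  assumes "f holomorphic_on UNIV"
  obtains g where "g holomorphic_on UNIV" "\<And>z. f z = f a + (z - a) * g z"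
proof
  show "(\<lambda>z. if z = a then deriv f a else (f z - f a) / (z - a)) holomorphic_on UNIV"
    by (rule pole_lemma_open[OF assms open_UNIV])
  show "f z = f a + (z - a) * (if z = a then deriv f a else (f z - f a) / (z - a))" for z by simp
qed

lemma quartic_le_quadratic_imp_zero:
  fixes c d M :: real
  assumes le: "\<And>r. r > 0 \<Longrightarrow> c\<^sup>2 * r ^ 4 / 2 \<le> (d + r)\<^sup>2 / 2 + M" and d: "d \<ge> 0"
  shows "c = 0"
proof (rule ccontr)
  assume c: "c \<noteq> 0"
  then have c2: "c\<^sup>2 > 0" by simp
  \<comment> \<open>For r \<ge> max 1 d the right-hand side is at most (2 + |M|) r^2, so dividing by
    r^2 gives r^2 \<le> \<open>K\<close>, which contradicts r^2 \<ge> r > \<open>K\<close>.\<close>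
  define K where "K = 2 * (2 + \<bar>M\<bar>) / c\<^sup>2"
  have K: "K > 0" using c2 by (simp add: K_def)
  define r where "r = 1 + d + K"
  have r: "r \<ge> 1" "r \<ge> d" "r > K" using d K by (auto simp: r_def)
  have "r * 1 \<le> r * r" using r by (intro mult_left_mono) auto
  then have rr: "r \<le> r\<^sup>2" "1 \<le> r\<^sup>2"
    using r order_trans[of 1 r "r * r"] by (auto simp: power2_eq_square)
  have "(d + r)\<^sup>2 \<le> (2 * r)\<^sup>2" using r d by (intro power_mono) auto
  then have "c\<^sup>2 * r ^ 4 / 2 \<le> 2 * r\<^sup>2 + M" using le[of r] r by simp
  also have "\<dots> \<le> 2 * r\<^sup>2 + \<bar>M\<bar> * r\<^sup>2"
    using mult_left_mono[OF rr(2), of "\<bar>M\<bar>"] by simp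
  finally have "r\<^sup>2 * (c\<^sup>2 * r\<^sup>2 / 2) \<le> r\<^sup>2 * (2 + \<bar>M\<bar>)" by (simp add: algebra_simps power4_eq_xxxx power2_eq_square)
  then have "c\<^sup>2 * r\<^sup>2 / 2 \<le> 2 + \<bar>M\<bar>" using rr by (subst (asm) mult_le_cancel_left_pos) auto
  then have "r\<^sup>2 \<le> K" using c2 by (simp add: K_def field_simps)
  then show False using rr r by simp
qed

text \<open>
  On the circle \<open>|z - z0| = r\<close> the harmonic function \<open>Re (cnj (c (z - z0)\<^sup>2) \<psi> z)\<close>, which the growth
  bound controls, is the real part of an entire function \<open>H\<close>: the negative powers of \<open>z - z0\<close> may be
  replaced by the conjugate positive ones. With \<open>c\<close> the second Taylor coefficient of \<open>\<psi>\<close>, the value of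
  \<open>H\<close> at the centre is \<open>|c|\<^sup>2 r\<^sup>4\<close>, which the maximum principle for \<open>g exp H\<close> compares with \<open>r\<^sup>2\<close>.
\<close>

lemma second_deriv_zero_of_gaussian_growth:
  fixes g \<psi> :: "complex \<Rightarrow> complex"
  assumes g: "g holomorphic_on UNIV" and \<psi>: "\<psi> holomorphic_on UNIV" and nz: "g z0 \<noteq> 0"
    and bound: "\<And>z. norm (g z) * exp ((norm (\<psi> z))\<^sup>2 / 2) \<le> C * exp ((norm z)\<^sup>2 / 2)"
  shows "deriv (deriv \<psi>) z0 = 0"
proof -
  obtain \<psi>1 where \<psi>1: "\<psi>1 holomorphic_on UNIV" "\<And>z. \<psi> z = \<psi> z0 + (z - z0) * \<psi>1 z"
    using entire_factor_linear[OF \<psi>] by metis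
  obtain q where q: "q holomorphic_on UNIV" "\<And>z. \<psi>1 z = \<psi>1 z0 + (z - z0) * q z"
    using entire_factor_linear[OF \<psi>1(1)] by metis
  define a0 a1 c where "a0 = \<psi> z0" and "a1 = \<psi>1 z0" and "c = q z0"
  have exp: "\<psi> z = a0 + a1 * (z - z0) + (z - z0)\<^sup>2 * q z" for z
    using \<psi>1(2)[of z] q(2)[of z] by (simp add: a0_def a1_def power2_eq_square algebra_simps)
  have C: "C > 0"
  proof -
    have "0 < norm (g z0) * exp ((norm (\<psi> z0))\<^sup>2 / 2)" using nz by simp
    also have "\<dots> \<le> C * exp ((norm z0)\<^sup>2 / 2)" by (rule bound)
    finally show ?thesis by (simp add: zero_less_mult_iff)
  qed
  have main: "(norm c)\<^sup>2 * r ^ 4 / 2 \<le> (norm z0 + r)\<^sup>2 / 2 + ln (C / norm (g z0))" if r: "r > 0" for r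
  proof -
    \<comment> \<open>With \<zeta> = z - z0, the terms belong to a0, a1 \<zeta> and \<zeta>^2 q. The
      first two products with cnj (c \<zeta>^2) are replaced by their conjugates, and \<zeta> cnj
      \<zeta> = r^2 is used in the second and third.\<close>
    define H where "H z = c * cnj a0 * (z - z0)\<^sup>2 + c * cnj a1 * r\<^sup>2 * (z - z0) + cnj c * r ^ 4 * q z" for z
    have holH: "H holomorphic_on UNIV" unfolding H_def by (intro holomorphic_intros q)
    have ReH: "Re (H z) = Re (cnj (c * (z - z0)\<^sup>2) * \<psi> z)" if z: "norm (z - z0) = r" for z
    proof -
      define \<zeta> where "\<zeta> = z - z0"
      have zz: "\<zeta> * cnj \<zeta> = of_real (r\<^sup>2)" by (simp only: \<zeta>_def complex_norm_square[symmetric] z)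
      have "cnj (c * \<zeta>\<^sup>2) * \<psi> z = cnj (c * cnj a0 * \<zeta>\<^sup>2) + cnj c * a1 * cnj \<zeta> * (\<zeta> * cnj \<zeta>) + cnj c * (\<zeta> * cnj \<zeta>)\<^sup>2 * q z"
        unfolding exp[of z] \<zeta>_def[symmetric] by (simp add: power2_eq_square algebra_simps)
      also have "\<dots> = cnj (c * cnj a0 * \<zeta>\<^sup>2) + cnj (c * cnj a1 * r\<^sup>2 * \<zeta>) + cnj c * r ^ 4 * q z"
        unfolding zz by (simp add: algebra_simps flip: power_mult)
      finally have "Re (cnj (c * \<zeta>\<^sup>2) * \<psi> z) =
          Re (c * cnj a0 * \<zeta>\<^sup>2) + Re (c * cnj a1 * r\<^sup>2 * \<zeta>) + Re (cnj c * r ^ 4 * q z)"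
        by (simp only: plus_complex.sel cnj.simps)
      then show ?thesis unfolding H_def \<zeta>_def[symmetric] by (simp only: plus_complex.sel)
    qed
    \<comment> \<open>Bounding Re H by |\<psi>|^2 / 2 + |c|^2 r^4 / 2 lets the growth hypothesis
      absorb the first summand. The second is only half of the value |c|^2 r^4 that H takes at the
      centre, and the other half is what remains in \<open>main\<close>.\<close>
    define B where "B = C * exp ((norm z0 + r)\<^sup>2 / 2 + (norm c)\<^sup>2 * r ^ 4 / 2)"
    have "norm (g z * exp (H z)) \<le> B" if z: "norm (z0 - z) = r" for z
    proof -
      have z': "norm (z - z0) = r" using z by (simp add: norm_minus_commute)
      have nz: "norm z \<le> norm z0 + r" using norm_triangle_sub[of z z0] z' by simp
      have "Re (H z) \<le> norm (cnj (c * (z - z0)\<^sup>2) * \<psi> z)" unfolding ReH[OF z'] by (rule complex_Re_le_cmod)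
      also have "\<dots> = (norm c * r\<^sup>2) * norm (\<psi> z)" by (simp only: norm_mult norm_power complex_mod_cnj z')
      also have "\<dots> \<le> (norm (\<psi> z))\<^sup>2 / 2 + (norm c)\<^sup>2 * r ^ 4 / 2"
        using sum_squares_bound[of "norm c * r\<^sup>2" "norm (\<psi> z)"]
        by (simp add: power_mult_distrib flip: power_mult)
      finally have "norm (g z * exp (H z)) \<le> norm (g z) * exp ((norm (\<psi> z))\<^sup>2 / 2 + (norm c)\<^sup>2 * r ^ 4 / 2)"
        by (simp add: norm_mult mult_left_mono)
      also have "\<dots> = norm (g z) * exp ((norm (\<psi> z))\<^sup>2 / 2) * exp ((norm c)\<^sup>2 * r ^ 4 / 2)"
        by (simp add: exp_add)
      also have "\<dots> \<le> C * exp ((norm z)\<^sup>2 / 2) * exp ((norm c)\<^sup>2 * r ^ 4 / 2)"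
        by (intro mult_right_mono bound) auto
      also have "\<dots> \<le> C * exp ((norm z0 + r)\<^sup>2 / 2) * exp ((norm c)\<^sup>2 * r ^ 4 / 2)"
        using C power_mono[OF nz, of 2] by (intro mult_right_mono mult_left_mono) auto
      also have "\<dots> = B" by (simp add: B_def exp_add)
      finally show ?thesis .
    qed
    moreover have hol: "(\<lambda>z. g z * exp (H z)) holomorphic_on UNIV" by (intro holomorphic_intros g holH)
    \<comment> \<open>Cauchy's inequality of order 0 is the maximum principle at the centre of the
      circle.\<close>
    ultimately have "norm ((deriv ^^ 0) (\<lambda>z. g z * exp (H z)) z0) \<le> fact 0 * B / r ^ 0"
      using r by (intro Cauchy_inequality[OF holomorphic_on_subset[OF hol] entire_continuous_on[OF hol]]) auto
    moreover have "H z0 = of_real ((norm c)\<^sup>2 * r ^ 4)"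
    proof -
      have "H z0 = (cnj c * c) * of_real (r ^ 4)" by (simp add: H_def c_def)
      also have "cnj c * c = of_real ((norm c)\<^sup>2)" by (simp only: complex_norm_square mult.commute)
      finally show ?thesis by (simp only: of_real_mult)
    qed
    ultimately have "norm (g z0) * exp ((norm c)\<^sup>2 * r ^ 4) \<le> B"
      by (simp add: norm_mult)
    then have "ln (norm (g z0) * exp ((norm c)\<^sup>2 * r ^ 4)) \<le> ln B"
      using nz C by (subst ln_le_cancel_iff) (auto simp: B_def)
    then show ?thesis using nz C by (simp add: B_def ln_mult ln_div)
  qed
  have "norm c = 0" by (rule quartic_le_quadratic_imp_zero[OF main]) auto
  then have c0: "q z0 = 0" by (simp add: c_def)
  have dq: "(q has_field_derivative deriv q z) (at z)" for z
    using q(1) holomorphic_derivI by blast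
  have d1: "deriv \<psi> z = a1 + 2 * (z - z0) * q z + (z - z0)\<^sup>2 * deriv q z" for z
  proof (rule DERIV_imp_deriv)
    have "((\<lambda>z. a0 + a1 * (z - z0) + (z - z0)\<^sup>2 * q z) has_field_derivative
        a1 + 2 * (z - z0) * q z + (z - z0)\<^sup>2 * deriv q z) (at z)"
      by (auto intro!: derivative_eq_intros dq simp: algebra_simps)
    then show "(\<psi> has_field_derivative a1 + 2 * (z - z0) * q z + (z - z0)\<^sup>2 * deriv q z) (at z)"
      using ext[of \<psi>, OF exp] by simp
  qed
  have ddq: "(deriv q has_field_derivative deriv (deriv q) z) (at z)" for z
    using holomorphic_derivI[OF holomorphic_deriv[OF q(1) open_UNIV] open_UNIV] by auto
  have "((\<lambda>z. a1 + 2 * (z - z0) * q z + (z - z0)\<^sup>2 * deriv q z) has_field_derivative 2 * q z0) (at z0)"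
    by (auto intro!: derivative_eq_intros dq ddq)
  moreover have "deriv \<psi> = (\<lambda>z. a1 + 2 * (z - z0) * q z + (z - z0)\<^sup>2 * deriv q z)" using d1 by blast
  ultimately show ?thesis using c0 by (auto intro: DERIV_imp_deriv)
qed

text \<open>The second derivative of \<open>\<psi>\<close> vanishes on the nonempty open set where g
  does not, hence everywhere by the identity theorem.\<close>

lemma affine_of_gaussian_growth:
  fixes g \<psi> :: "complex \<Rightarrow> complex"
  assumes g: "g holomorphic_on UNIV" "g z0 \<noteq> 0" and \<psi>: "\<psi> holomorphic_on UNIV" "\<not> \<psi> constant_on UNIV"
    and bound: "\<And>z. norm (g z) * exp ((norm (\<psi> z))\<^sup>2 / 2) \<le> C * exp ((norm z)\<^sup>2 / 2)"
  obtains a b where "a \<noteq> 0" "\<psi> = (\<lambda>z. b + a * z)"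
proof -
  have op: "open {z. g z \<noteq> 0}" by (intro open_Collect_neq entire_continuous_on g) auto
  have hol: "deriv (deriv \<psi>) holomorphic_on UNIV"
    by (intro holomorphic_deriv \<psi>) auto
  have "deriv (deriv \<psi>) z = 0" if "g z \<noteq> 0" for z
    by (rule second_deriv_zero_of_gaussian_growth[OF g(1) \<psi>(1) that bound])
  then have dd: "deriv (deriv \<psi>) z = 0" for z
    using analytic_continuation_open[OF op open_UNIV _ connected_UNIV subset_UNIV hol holomorphic_on_const[of 0], of z] g(2)
    by auto
  have "(deriv \<psi> has_field_derivative 0) (at z)" for z
    using holomorphic_derivI[OF holomorphic_deriv[OF \<psi>(1) open_UNIV] open_UNIV UNIV_I, of z] dd by simp
  then obtain a where a: "\<And>z. deriv \<psi> z = a"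
    using has_field_derivative_zero_constant[of UNIV "deriv \<psi>"] by auto
  have "((\<lambda>z. \<psi> z - a * z) has_field_derivative 0) (at z)" for z
    using holomorphic_derivI[OF \<psi>(1) open_UNIV UNIV_I, of z] a
    by (auto intro!: derivative_eq_intros)
  then obtain b where b: "\<And>z. \<psi> z - a * z = b"
    using has_field_derivative_zero_constant[of UNIV "\<lambda>z. \<psi> z - a * z"] by auto
  have eq: "\<psi> = (\<lambda>z. b + a * z)" using b by (auto simp: algebra_simps)
  moreover have "a \<noteq> 0" using \<psi>(2) eq by (auto simp: constant_on_def)
  ultimately show thesis using that by blast
qed

lemma L_fun_eq:
  "L_fun u \<psi> n z = norm (u z) * norm (\<psi> z) ^ n * exp ((norm (\<psi> z))\<^sup>2 / 2) * exp (- ((norm z)\<^sup>2 / 2))"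
proof -
  have e: "1 / 2 * (x - y) = x / 2 + - (y / 2)" for x y :: real by simp
  show ?thesis unfolding L_fun_def e exp_add by (simp only: mult.assoc)
qed

text \<open>The kernel centred at \<open>\<psi> z\<close> is tested and its image evaluated at z:
  the n-th derivative contributes |\<psi> z|^n and the kernel exp (|\<psi> z|^2 / 2), which together
  give exactly \<open>L_fun\<close>.\<close>

lemma L_fun_bounded:
  assumes p: "1 \<le> p" and bdd: "bounded_on_fock p (wcd_op u \<psi> n)"
  obtains C where "\<And>z. L_fun u \<psi> n z \<le> C"
proof -
  obtain C where C: "C > 0" "\<And>f w. f \<in> fock_space p \<Longrightarrow> wmod f w \<le> C * fock_norm p f"
    using wmod_le_fock_norm[OF p] by blast
  obtain K where K: "K > 0" "\<And>w. fock_kernel w \<in> fock_space p \<and> fock_norm p (fock_kernel w) \<le> K"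
    using fock_kernel_bounded[OF p] by blast
  obtain D where D: "\<And>f. f \<in> fock_space p \<Longrightarrow> wcd_op u \<psi> n f \<in> fock_space p"
      "\<And>f. f \<in> fock_space p \<Longrightarrow> fock_norm p (wcd_op u \<psi> n f) \<le> D * fock_norm p f"
    using bdd by (auto simp: bounded_on_fock_def)
  have "L_fun u \<psi> n z \<le> C * (\<bar>D\<bar> * K)" for z
  proof -
    define k where "k = fock_kernel (\<psi> z)"
    have k: "k \<in> fock_space p" "fock_norm p k \<le> K" using K by (auto simp: k_def)
    have "norm (k (\<psi> z)) = exp ((norm (\<psi> z))\<^sup>2 / 2)"
    proof -
      have "cnj (\<psi> z) * \<psi> z = of_real ((norm (\<psi> z))\<^sup>2)"
        by (simp only: complex_norm_square mult.commute)
      then have "k (\<psi> z) = exp (of_real ((norm (\<psi> z))\<^sup>2 / 2))"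
        unfolding k_def fock_kernel_def by simp
      then show ?thesis by (simp only: norm_exp_eq_Re Re_complex_of_real)
    qed
    then have "wmod (wcd_op u \<psi> n k) z = norm (u z) * (norm (\<psi> z) ^ n * exp ((norm (\<psi> z))\<^sup>2 / 2)) * exp (- ((norm z)\<^sup>2 / 2))"
      unfolding wmod_def wcd_op_def k_def higher_deriv_fock_kernel by (simp add: norm_mult norm_power)
    also have "\<dots> = L_fun u \<psi> n z" by (simp only: L_fun_eq mult.assoc)
    finally have "L_fun u \<psi> n z \<le> C * fock_norm p (wcd_op u \<psi> n k)" using C(2)[OF D(1)[OF k(1)], of z] by simp
    also have "\<dots> \<le> C * (\<bar>D\<bar> * K)"
    proof -
      have "fock_norm p (wcd_op u \<psi> n k) \<le> D * fock_norm p k" by (rule D(2)[OF k(1)])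
      also have "\<dots> \<le> \<bar>D\<bar> * fock_norm p k" by (intro mult_right_mono) auto
      also have "\<dots> \<le> \<bar>D\<bar> * K" using k(2) by (intro mult_left_mono) auto
      finally show ?thesis using C(1) by (intro mult_left_mono) auto
    qed
    finally show ?thesis .
  qed
  then show thesis using that by blast
qed

text \<open>The growth lemma is applied to g = u \<psi>^n. It needs one point where neither u nor
  \<open>\<psi>\<close> vanishes; this exists because the image of an open set under
  \<open>\<psi>\<close> is open and so cannot be {0}.\<close>

lemma symbol_affine:
  assumes u: "u holomorphic_on UNIV" "u z0 \<noteq> 0" and \<psi>: "\<psi> holomorphic_on UNIV" "\<not> \<psi> constant_on UNIV"
    and L: "\<And>z. L_fun u \<psi> n z \<le> C"
  obtains a b where "a \<noteq> 0" "\<psi> = (\<lambda>z. b + a * z)"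
proof -
  have "open (\<psi> ` {z. u z \<noteq> 0})"
    by (rule open_mapping_thm[OF \<psi>(1) open_UNIV connected_UNIV _ subset_UNIV \<psi>(2)])
      (intro open_Collect_neq entire_continuous_on u continuous_on_const)
  then have "\<psi> ` {z. u z \<noteq> 0} \<noteq> {0}" using not_open_singleton by metis
  then obtain z1 where z1: "u z1 \<noteq> 0" "\<psi> z1 \<noteq> 0" using u(2) by (cases "\<psi> z0 = 0") force+
  have "(\<lambda>z. u z * \<psi> z ^ n) holomorphic_on UNIV" by (intro holomorphic_intros u \<psi>)
  moreover have "u z1 * \<psi> z1 ^ n \<noteq> 0" using z1 by simp
  moreover have "norm (u z * \<psi> z ^ n) * exp ((norm (\<psi> z))\<^sup>2 / 2) \<le> C * exp ((norm z)\<^sup>2 / 2)" for z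
    using mult_right_mono[OF L[of z], of "exp ((norm z)\<^sup>2 / 2)"]
    by (simp add: L_fun_eq norm_mult norm_power mult.assoc flip: exp_add)
  ultimately show thesis
    using affine_of_gaussian_growth[OF _ _ \<psi>] that by blast
qed

section \<open>Boundedness below and sampling\<close>

text \<open>
  Replacing \<open>|\<psi> z|\<^sup>n\<close> by \<open>(1 + |\<psi> z|)\<^sup>n\<close> in \<open>L_fun\<close> gives the exact factor between the weighted
  modulus of the image at \<open>z\<close> and the sampling weight at \<open>\<psi> z\<close>.
\<close>

definition L1_fun :: "(complex \<Rightarrow> complex) \<Rightarrow> (complex \<Rightarrow> complex) \<Rightarrow> nat \<Rightarrow> complex \<Rightarrow> real" where
  "L1_fun u \<psi> n z =
     norm (u z) * (1 + norm (\<psi> z)) ^ n * exp ((norm (\<psi> z))\<^sup>2 / 2) * exp (- ((norm z)\<^sup>2 / 2))"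

lemma L1_fun_nonneg: "0 \<le> L1_fun u \<psi> n z"
  by (simp add: L1_fun_def)

lemma wmod_wcd_op: "wmod (wcd_op u \<psi> n f) z = L1_fun u \<psi> n z * wder n f (\<psi> z)"
proof -
  have "exp ((norm (\<psi> z))\<^sup>2 / 2) * exp (- ((norm (\<psi> z))\<^sup>2 / 2)) = 1" by (simp flip: exp_add)
  moreover have "(1 + norm (\<psi> z)) ^ n \<noteq> 0" using norm_ge_zero[of "\<psi> z"] by (simp add: add_nonneg_eq_0_iff)
  ultimately show ?thesis
    unfolding wmod_def wcd_op_def L1_fun_def wder_def by (simp add: norm_mult field_simps)
qed

lemma L_fun_le_L1_fun: "L_fun u \<psi> n z \<le> L1_fun u \<psi> n z"
  unfolding L_fun_eq L1_fun_def by (intro mult_right_mono mult_left_mono power_mono) auto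

lemma L1_fun_le_L_fun:
  assumes "s > 0" "norm (\<psi> z) \<ge> s"
  shows "L1_fun u \<psi> n z \<le> (1 + 1 / s) ^ n * L_fun u \<psi> n z"
proof -
  have "1 + norm (\<psi> z) \<le> (1 + 1 / s) * norm (\<psi> z)" using assms by (simp add: field_simps)
  then have "(1 + norm (\<psi> z)) ^ n \<le> (1 + 1 / s) ^ n * norm (\<psi> z) ^ n"
    unfolding power_mult_distrib[symmetric] by (intro power_mono) auto
  then have "L1_fun u \<psi> n z \<le>
      norm (u z) * ((1 + 1 / s) ^ n * norm (\<psi> z) ^ n) * exp ((norm (\<psi> z))\<^sup>2 / 2) * exp (- ((norm z)\<^sup>2 / 2))"
    unfolding L1_fun_def by (intro mult_right_mono mult_left_mono) auto
  then show ?thesis unfolding L_fun_eq by (simp add: mult_ac)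
qed

lemma L1_fun_continuous:
  assumes "u holomorphic_on UNIV" "\<psi> holomorphic_on UNIV"
  shows "continuous_on A (L1_fun u \<psi> n)"
  unfolding L1_fun_def[abs_def] by (intro continuous_intros entire_continuous_on assms) auto

lemma L_fun_continuous:
  assumes "u holomorphic_on UNIV" "\<psi> holomorphic_on UNIV"
  shows "continuous_on A (L_fun u \<psi> n)"
  unfolding L_fun_def[abs_def] by (intro continuous_intros entire_continuous_on assms)

lemma bounded_below_enorm_iff:
  assumes bdd: "bounded_on_fock p T" and M: "M \<subseteq> fock_space p"
  shows "(\<exists>c>0. \<forall>f\<in>M. c * fock_norm p f \<le> fock_norm p (T f)) \<longleftrightarrow>
    (\<exists>c>0. \<forall>f\<in>M. ennreal c * fock_enorm p f \<le> fock_enorm p (T f))"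
proof -
  have "c * fock_norm p f \<le> fock_norm p (T f) \<longleftrightarrow> ennreal c * fock_enorm p f \<le> fock_enorm p (T f)"
    if "c > 0" "f \<in> M" for c f
  proof -
    have F: "f \<in> fock_space p" "T f \<in> fock_space p" using that M bdd by (auto simp: bounded_on_fock_def)
    show ?thesis
      using that by (simp flip: ennreal_fock_norm[OF F(1)] ennreal_fock_norm[OF F(2)] ennreal_mult)
  qed
  then show ?thesis by meson
qed

text \<open>What remains of the boundedness of the operator: the form of the symbol and the bound on
  \<open>L_fun\<close>. The exponent p is not fixed here.\<close>

locale affine_symbol =
  fixes u \<psi> :: "complex \<Rightarrow> complex" and n :: nat and a b :: complex and C :: real
  assumes u: "u holomorphic_on UNIV" and a: "a \<noteq> 0" and \<psi>: "\<psi> = (\<lambda>z. b + a * z)"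
    and L_le: "\<And>z. L_fun u \<psi> n z \<le> C"
begin

abbreviation T where "T \<equiv> wcd_op u \<psi> n"

lemma holomorphic_\<psi>: "\<psi> holomorphic_on UNIV"
  unfolding \<psi> by (intro holomorphic_intros)

lemma norm_\<psi>: "norm (\<psi> z) = norm a * dist (- b / a) z"
proof -
  have "\<psi> z = a * (z - (- b / a))" using a by (simp add: \<psi> field_simps)
  then show ?thesis by (simp only: norm_mult dist_norm norm_minus_commute[of z])
qed

text \<open>The set |\<psi> z| \<le> 1 is a compact disc, on which continuity suffices; outside it
  \<open>L1_fun\<close> is at most 2^n times \<open>L_fun\<close>.\<close>

lemma L1_bounded:
  obtains C1 where "C1 > 0" "\<And>z. L1_fun u \<psi> n z \<le> C1"
proof -
  have "bounded (L1_fun u \<psi> n ` cball (- b / a) (1 / norm a))"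
    by (intro compact_imp_bounded compact_continuous_image L1_fun_continuous u holomorphic_\<psi> compact_cball)
  then obtain B where B': "\<forall>x\<in>L1_fun u \<psi> n ` cball (- b / a) (1 / norm a). norm x \<le> B"
    unfolding bounded_iff by blast
  have B: "L1_fun u \<psi> n z \<le> B" if "z \<in> cball (- b / a) (1 / norm a)" for z
    using bspec[OF B' imageI[OF that]] by simp
  have "L1_fun u \<psi> n z \<le> max 1 (max B (2 ^ n * C))" for z
  proof (cases "norm (\<psi> z) \<le> 1")
    case True
    then have "z \<in> cball (- b / a) (1 / norm a)" using a by (simp add: norm_\<psi> field_simps)
    then show ?thesis using B[of z] by simp
  next
    case False
    then have "L1_fun u \<psi> n z \<le> (1 + 1 / 1) ^ n * L_fun u \<psi> n z" by (intro L1_fun_le_L_fun) auto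
    also have "\<dots> \<le> 2 ^ n * C" using L_le[of z] by (simp add: mult_left_mono)
    finally show ?thesis by simp
  qed
  then show thesis using that[of "max 1 (max B (2 ^ n * C))"] by simp
qed

text \<open>As \<open>\<psi>\<close> is invertible, its image of a superlevel set is again one, of a
  continuous function of w; openness and measurability follow.\<close>

lemma G_set_eq: "G_set u \<psi> n \<epsilon> = {w. L_fun u \<psi> n ((w - b) / a) > \<epsilon>}"
  unfolding G_set_def Omega_set_def
proof (intro set_eqI iffI)
  fix w assume "w \<in> {w. \<epsilon> < L_fun u \<psi> n ((w - b) / a)}"
  then show "w \<in> \<psi> ` {z. \<epsilon> < L_fun u \<psi> n z}"
    using a by (intro image_eqI[of _ _ "(w - b) / a"]) (auto simp: \<psi>)
qed (use a in \<open>auto simp: \<psi>\<close>)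

lemma G_set_borel: "G_set u \<psi> n \<epsilon> \<in> sets borel"
proof -
  have "open (G_set u \<psi> n \<epsilon>)" unfolding G_set_eq
    by (intro open_Collect_less continuous_intros continuous_on_compose2[OF L_fun_continuous[OF u holomorphic_\<psi>, of UNIV]])
      (use a in auto)
  then show ?thesis by simp
qed

section \<open>The supremum norm\<close>

text \<open>The points with |\<psi> z| < 1, where \<open>L_fun\<close> says little about
  \<open>L1_fun\<close>, are reached from the circle |\<psi> z| = 1 by the maximum principle for the
  entire function \<open>T f\<close>; the weight is compared on a fixed disc only.\<close>

lemma bounded_below_imp_sampling_infinity:
  assumes p: "p = \<infinity>" and c: "c > 0" "\<And>f. f \<in> fock_space0 p n \<Longrightarrow> ennreal c * fock_enorm p f \<le> fock_enorm p (T f)"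
  shows "\<exists>\<epsilon>>0. sampling_set p n (G_set u \<psi> n \<epsilon>) (fock_space0 p n)"
proof -
  obtain C1 where C1: "C1 > 0" "\<And>z. L1_fun u \<psi> n z \<le> C1" using L1_bounded by blast
  \<comment> \<open>The disc |\<psi> z| \<le> 1 has centre - b / a and radius 1 / |a|, so |z| \<le>
    \<open>R\<close> on it and \<open>E\<close> bounds the reciprocal of the weight.\<close>
  define R where "R = norm (- b / a) + 1 / norm a"
  define E where "E = exp (R\<^sup>2 / 2)"
  have E: "E \<ge> 1" by (simp add: E_def)
  define K :: real where "K = fact n * exp (3 / 2)"
  have K: "K > 0" by (simp add: K_def)
  \<comment> \<open>Chosen so that the error E * 2^n * \<epsilon> * K * N equals c * N / 2 and is
    absorbed by the left-hand side; \<open>\<delta>\<close> is what the other half leaves.\<close>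
  define \<epsilon> where "\<epsilon> = c / (2 * E * 2 ^ n * K)"
  have \<epsilon>: "\<epsilon> > 0" using c E K by (simp add: \<epsilon>_def)
  define \<delta> where "\<delta> = c / (2 * E * C1)"
  have \<delta>: "\<delta> > 0" using c E C1 by (simp add: \<delta>_def)
  have "ennreal \<delta> * fock_enorm p f \<le> sampling_enorm p n (G_set u \<psi> n \<epsilon>) f" if f: "f \<in> fock_space0 p n" for f
  proof (cases "sampling_enorm p n (G_set u \<psi> n \<epsilon>) f")
    case (real s)
    have F: "f \<in> fock_space p" using f by (rule fock_space0D)
    have hf: "f holomorphic_on UNIV" by (rule fock_spaceD[OF F])
    define N where "N = fock_norm p f"
    have N: "fock_enorm p f = ennreal N" "N \<ge> 0" using ennreal_fock_norm[OF F] by (auto simp: N_def)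
    have "wmod f z \<le> N" for z
    proof -
      have "ennreal (wmod f z) \<le> fock_enorm p f" unfolding fock_enorm_infinity[OF p] by (auto intro: SUP_upper)
      then show ?thesis using N by simp
    qed
    then have wN: "wder n f w \<le> K * N" for w unfolding K_def by (rule wder_le_of_wmod_le[OF hf])
    have ws: "wder n f w \<le> s" if "w \<in> G_set u \<psi> n \<epsilon>" for w
    proof -
      have "ennreal (wder n f w) \<le> sampling_enorm p n (G_set u \<psi> n \<epsilon>) f"
        unfolding sampling_enorm_infinity[OF p] using that by (auto intro: SUP_upper)
      then show ?thesis using real by simp
    qed
    \<comment> \<open>The first summand serves points with \<open>L_fun\<close> above \<epsilon>,
      whose images the sampling set sees; the second serves those with \<open>L_fun\<close> at most
      \<epsilon>, where \<open>L1_fun\<close> is at most 2^n \<epsilon>.\<close>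
    define X where "X = C1 * s + 2 ^ n * \<epsilon> * (K * N)"
    have X: "X \<ge> 0" using C1 \<epsilon> K N real by (simp add: X_def)
    have out: "wmod (T f) z \<le> X" if z: "norm (\<psi> z) \<ge> 1" for z
    proof (cases "L_fun u \<psi> n z > \<epsilon>")
      case True
      then have "\<psi> z \<in> G_set u \<psi> n \<epsilon>" by (auto simp: G_set_def Omega_set_def)
      then have "wmod (T f) z \<le> C1 * s"
        unfolding wmod_wcd_op using C1 by (intro mult_mono ws) (auto simp: less_imp_le)
      also have "\<dots> \<le> X" using \<epsilon> K N by (simp add: X_def)
      finally show ?thesis .
    next
      case False
      have "L1_fun u \<psi> n z \<le> (1 + 1 / 1) ^ n * L_fun u \<psi> n z" using z by (intro L1_fun_le_L_fun) auto
      also have "\<dots> \<le> 2 ^ n * \<epsilon>" using False by simp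
      finally have "wmod (T f) z \<le> 2 ^ n * \<epsilon> * (K * N)"
        unfolding wmod_wcd_op using \<epsilon> by (intro mult_mono wN) auto
      also have "\<dots> \<le> X" using C1 real by (simp add: X_def)
      finally show ?thesis .
    qed
    have "wmod (T f) z \<le> E * X" for z
    proof (cases "norm (\<psi> z) \<ge> 1")
      case True
      have "wmod (T f) z \<le> 1 * X" using out[OF True] by simp
      also have "\<dots> \<le> E * X" using E X by (intro mult_right_mono)
      finally show ?thesis .
    next
      case False
      have hT: "T f holomorphic_on UNIV" unfolding wcd_op_def
        by (intro holomorphic_intros u holomorphic_on_compose_gen[OF holomorphic_\<psi> entire_higher_deriv[OF hf], unfolded o_def]) auto
      have r: "1 / norm a > 0" using a by simp
      have "norm (T f z) \<le> E * X"
      proof (rule maximum_modulus_frontier[of "T f" "ball (- b / a) (1 / norm a)"])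
        show "z \<in> ball (- b / a) (1 / norm a)" using False a by (simp add: norm_\<psi> field_simps)
        fix w assume "w \<in> frontier (ball (- b / a) (1 / norm a))"
        then have w: "dist (- b / a) w = 1 / norm a" using r by (simp add: frontier_ball)
        then have "norm (\<psi> w) = 1" using a by (simp add: norm_\<psi>)
        then have "wmod (T f) w \<le> X" by (intro out) simp
        moreover have "norm w \<le> R"
          using norm_triangle_ineq2[of w "- b / a"] w by (simp add: R_def dist_norm norm_minus_commute)
        then have "exp ((norm w)\<^sup>2 / 2) \<le> E" by (simp add: E_def power_mono)
        ultimately have "exp ((norm w)\<^sup>2 / 2) * wmod (T f) w \<le> E * X" by (intro mult_mono) (auto simp: E_def)
        moreover have "norm (T f w) = exp ((norm w)\<^sup>2 / 2) * wmod (T f) w"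
          by (simp add: wmod_def flip: exp_add)
        ultimately show "norm (T f w) \<le> E * X" by simp
      qed (auto intro: holomorphic_on_subset[OF hT] entire_continuous_on[OF hT])
      moreover have "wmod (T f) z \<le> norm (T f z)" unfolding wmod_def by (intro mult_left_le) auto
      ultimately show ?thesis by simp
    qed
    then have "fock_enorm p (T f) \<le> ennreal (E * X)"
      unfolding fock_enorm_infinity[OF p] by (intro SUP_least ennreal_leI)
    then have "ennreal c * ennreal N \<le> ennreal (E * X)" using c(2)[OF f] N(1) by (auto intro: order_trans)
    then have "c * N \<le> E * X" using c(1) N(2) E X by (simp flip: ennreal_mult)
    also have "E * X = E * C1 * s + c * N / 2" using E K by (simp add: X_def \<epsilon>_def field_simps)
    finally have "c * N \<le> 2 * E * C1 * s" by simp
    then have "\<delta> * N \<le> s" using E C1 by (simp add: \<delta>_def field_simps)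
    then show ?thesis unfolding N(1) real using \<delta> N(2) by (simp add: ennreal_leI flip: ennreal_mult)
  qed simp
  then show ?thesis using \<epsilon> \<delta> unfolding sampling_set_def by blast
qed

text \<open>At w = \<open>\<psi> z\<close> in the sampling set the factor satisfies
  \<open>L1_fun\<close> \<ge> \<open>L_fun\<close> > \<epsilon>; all other points are
  discarded.\<close>

lemma sampling_imp_bounded_below_infinity:
  assumes p: "p = \<infinity>" and \<epsilon>: "\<epsilon> > 0" and S: "sampling_set p n (G_set u \<psi> n \<epsilon>) M"
  shows "\<exists>c>0. \<forall>f\<in>M. ennreal c * fock_enorm p f \<le> fock_enorm p (T f)"
proof -
  obtain \<delta> where \<delta>: "\<delta> > 0" "\<And>f. f \<in> M \<Longrightarrow> ennreal \<delta> * fock_enorm p f \<le> sampling_enorm p n (G_set u \<psi> n \<epsilon>) f"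
    using S by (auto simp: sampling_set_def)
  have "ennreal (\<epsilon> * \<delta>) * fock_enorm p f \<le> fock_enorm p (T f)" if f: "f \<in> M" for f
  proof -
    have "ennreal (\<epsilon> * \<delta>) * fock_enorm p f = ennreal \<epsilon> * (ennreal \<delta> * fock_enorm p f)"
      using \<epsilon> \<delta>(1) by (simp add: ennreal_mult mult.assoc)
    also have "\<dots> \<le> ennreal \<epsilon> * sampling_enorm p n (G_set u \<psi> n \<epsilon>) f" by (intro mult_left_mono \<delta>(2) f) auto
    also have "\<dots> = (SUP w\<in>G_set u \<psi> n \<epsilon>. ennreal \<epsilon> * ennreal (wder n f w))"
      unfolding sampling_enorm_infinity[OF p] by (simp add: SUP_mult_left_ennreal)
    also have "\<dots> \<le> fock_enorm p (T f)"
    proof (intro SUP_least)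
      fix w assume "w \<in> G_set u \<psi> n \<epsilon>"
      then obtain z where z: "w = \<psi> z" "L_fun u \<psi> n z > \<epsilon>" by (auto simp: G_set_def Omega_set_def)
      have "\<epsilon> * wder n f w \<le> wmod (T f) z"
        unfolding wmod_wcd_op z(1) using z(2) L_fun_le_L1_fun[of u \<psi> n z] by (intro mult_right_mono) auto
      then have "ennreal \<epsilon> * ennreal (wder n f w) \<le> ennreal (wmod (T f) z)"
        using \<epsilon> by (simp add: ennreal_leI flip: ennreal_mult)
      also have "\<dots> \<le> fock_enorm p (T f)" unfolding fock_enorm_infinity[OF p] by (auto intro: SUP_upper)
      finally show "ennreal \<epsilon> * ennreal (wder n f w) \<le> fock_enorm p (T f)" .
    qed
    finally show ?thesis .
  qed
  then show ?thesis using \<epsilon> \<delta>(1) by (intro exI[of _ "\<epsilon> * \<delta>"]) auto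
qed

section \<open>Finite exponents\<close>

lemma fint_wcd_op:
  assumes "f holomorphic_on UNIV"
  shows "ennreal ((norm a)\<^sup>2) * fint q (T f) =
    (\<integral>\<^sup>+w. ennreal ((L1_fun u \<psi> n ((w - b) / a) * wder n f w) powr q) \<partial>lborel)"
proof -
  have [measurable]: "wder n f \<in> borel_measurable borel" by (rule wder_measurable[OF assms])
  have [measurable]: "L1_fun u \<psi> n \<in> borel_measurable borel"
    by (intro borel_measurable_continuous_onI L1_fun_continuous u holomorphic_\<psi>)
  have "(\<integral>\<^sup>+w. ennreal ((L1_fun u \<psi> n ((w - b) / a) * wder n f w) powr q) \<partial>lborel) =
     ennreal ((norm a)\<^sup>2) * (\<integral>\<^sup>+z. ennreal ((L1_fun u \<psi> n ((b + a * z - b) / a) * wder n f (b + a * z)) powr q) \<partial>lborel)"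
    using a by (intro nn_integral_complex_affine) auto
  also have "(\<integral>\<^sup>+z. ennreal ((L1_fun u \<psi> n ((b + a * z - b) / a) * wder n f (b + a * z)) powr q) \<partial>lborel) = fint q (T f)"
    unfolding fint_def wmod_wcd_op using a by (simp add: \<psi>)
  finally show ?thesis by simp
qed

lemma sampling_imp_fint_le:
  assumes f: "f holomorphic_on UNIV" and \<epsilon>: "\<epsilon> > 0" and q: "q \<ge> 1"
  shows "ennreal (\<epsilon> powr q) * dint q n (G_set u \<psi> n \<epsilon>) f \<le> ennreal ((norm a)\<^sup>2) * fint q (T f)"
proof -
  have [measurable]: "wder n f \<in> borel_measurable borel" by (rule wder_measurable[OF f])
  have [measurable]: "G_set u \<psi> n \<epsilon> \<in> sets borel" by (rule G_set_borel)
  have "ennreal (\<epsilon> powr q) * dint q n (G_set u \<psi> n \<epsilon>) f =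
      (\<integral>\<^sup>+w. ennreal (\<epsilon> powr q) * (ennreal (wder n f w powr q) * indicator (G_set u \<psi> n \<epsilon>) w) \<partial>lborel)"
    unfolding dint_def by (rule nn_integral_cmult[symmetric]) auto
  also have "\<dots> \<le> (\<integral>\<^sup>+w. ennreal ((L1_fun u \<psi> n ((w - b) / a) * wder n f w) powr q) \<partial>lborel)"
  proof (rule nn_integral_mono)
    fix w
    show "ennreal (\<epsilon> powr q) * (ennreal (wder n f w powr q) * indicator (G_set u \<psi> n \<epsilon>) w) \<le>
        ennreal ((L1_fun u \<psi> n ((w - b) / a) * wder n f w) powr q)"
    proof (cases "w \<in> G_set u \<psi> n \<epsilon>")
      case True
      then have "\<epsilon> \<le> L1_fun u \<psi> n ((w - b) / a)"
        using L_fun_le_L1_fun[of u \<psi> n "(w - b) / a"] by (simp add: G_set_eq)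
      then have "(\<epsilon> * wder n f w) powr q \<le> (L1_fun u \<psi> n ((w - b) / a) * wder n f w) powr q"
        using \<epsilon> q by (intro powr_mono2 mult_right_mono) auto
      then show ?thesis using True by (simp add: powr_mult ennreal_leI flip: ennreal_mult)
    qed simp
  qed
  also have "\<dots> = ennreal ((norm a)\<^sup>2) * fint q (T f)" by (rule fint_wcd_op[OF f, symmetric])
  finally show ?thesis .
qed

text \<open>The w-plane is covered by the sampling set, the disc of radius s about 0 and the rest.
  On the sampling set the factor is at most \<open>C1\<close>; on the disc a pointwise bound is
  multiplied by the area; on the rest the factor is at most (1 + 1 / s)^n \<epsilon>, and the
  integral is enlarged to the whole plane. The error terms become small by choosing s and, depending
  on s, \<epsilon>.\<close>

lemma fint_le_dint_add:
  assumes f: "f holomorphic_on UNIV" and \<epsilon>: "\<epsilon> > 0" and q: "q \<ge> 1" and s: "s > 0"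
    and C1: "C1 > 0" "\<And>z. L1_fun u \<psi> n z \<le> C1"
    and K: "K > 0" "\<And>w. ennreal (wder n f w powr q) \<le> ennreal K * fint q f" "dint q n UNIV f \<le> ennreal K * fint q f"
  shows "ennreal ((norm a)\<^sup>2) * fint q (T f) \<le> ennreal (C1 powr q) * dint q n (G_set u \<psi> n \<epsilon>) f +
    ennreal (((1 + 1 / s) ^ n * \<epsilon>) powr q * K + C1 powr q * (pi * s\<^sup>2) * K) * fint q f"
proof -
  have [measurable]: "wder n f \<in> borel_measurable borel" by (rule wder_measurable[OF f])
  have [measurable]: "G_set u \<psi> n \<epsilon> \<in> sets borel" by (rule G_set_borel)
  have [measurable]: "ball (0::complex) s \<in> sets borel" by simp
  let ?A = "\<lambda>w. ennreal (wder n f w powr q)"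
  define \<eta> where "\<eta> = (1 + 1 / s) ^ n * \<epsilon>"
  have \<eta>: "\<eta> > 0" using s \<epsilon> by (simp add: \<eta>_def add_pos_pos)
  have "ennreal ((L1_fun u \<psi> n ((w - b) / a) * wder n f w) powr q) \<le>
      ennreal (C1 powr q) * (?A w * indicator (G_set u \<psi> n \<epsilon>) w) +
      (ennreal (\<eta> powr q) * (?A w * indicator UNIV w) + ennreal (C1 powr q) * ((ennreal K * fint q f) * indicator (ball 0 s) w))"
    (is "?l \<le> ?x + (?y + ?z)") for w
  proof -
    have le: "?l \<le> ennreal (c powr q) * ?A w" if "L1_fun u \<psi> n ((w - b) / a) \<le> c" for c
    proof -
      have "(L1_fun u \<psi> n ((w - b) / a) * wder n f w) powr q \<le> (c * wder n f w) powr q"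
        using q that by (intro powr_mono2 mult_right_mono mult_nonneg_nonneg L1_fun_nonneg) auto
      then show ?thesis by (simp add: powr_mult ennreal_leI flip: ennreal_mult)
    qed
    have \<psi>w: "\<psi> ((w - b) / a) = w" using a by (simp add: \<psi>)
    consider "w \<in> G_set u \<psi> n \<epsilon>" | "w \<in> ball 0 s" | "w \<notin> G_set u \<psi> n \<epsilon>" "w \<notin> ball 0 s" by blast
    then show ?thesis
    proof cases
      case 1
      have "?l \<le> ?x" using le[OF C1(2)] 1 by simp
      then show ?thesis by (rule order_trans) simp
    next
      case 2
      have "?l \<le> ennreal (C1 powr q) * ?A w" by (rule le[OF C1(2)])
      also have "\<dots> \<le> ?z" using 2 K(2)[of w] by (simp add: mult_left_mono)
      also have "\<dots> \<le> ?x + (?y + ?z)" by (simp add: add.assoc[symmetric])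
      finally show ?thesis .
    next
      case 3
      have "L1_fun u \<psi> n ((w - b) / a) \<le> (1 + 1 / s) ^ n * L_fun u \<psi> n ((w - b) / a)"
        using s 3 \<psi>w by (intro L1_fun_le_L_fun) auto
      also have "\<dots> \<le> \<eta>" unfolding \<eta>_def using s 3 by (intro mult_left_mono) (auto simp: G_set_eq)
      finally have "?l \<le> ?y" using le by simp
      also have "\<dots> \<le> ?x + (?y + ?z)" by (simp add: add.left_commute)
      finally show ?thesis .
    qed
  qed
  then have "(\<integral>\<^sup>+w. ennreal ((L1_fun u \<psi> n ((w - b) / a) * wder n f w) powr q) \<partial>lborel) \<le>
    (\<integral>\<^sup>+w. ennreal (C1 powr q) * (?A w * indicator (G_set u \<psi> n \<epsilon>) w) +
      (ennreal (\<eta> powr q) * (?A w * indicator UNIV w) + ennreal (C1 powr q) * ((ennreal K * fint q f) * indicator (ball 0 s) w)) \<partial>lborel)"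
    by (intro nn_integral_mono)
  also have "\<dots> = ennreal (C1 powr q) * dint q n (G_set u \<psi> n \<epsilon>) f +
      (ennreal (\<eta> powr q) * dint q n UNIV f + ennreal (C1 powr q) * (ennreal K * fint q f * ennreal (pi * s\<^sup>2)))"
  proof -
    have "(\<integral>\<^sup>+w. ennreal (C1 powr q) * ((ennreal K * fint q f) * indicator (ball (0::complex) s) w) \<partial>lborel) =
        ennreal (C1 powr q) * (ennreal K * fint q f * ennreal (pi * s\<^sup>2))"
      using s by (subst nn_integral_cmult) (auto simp: nn_integral_cmult_indicator emeasure_lborel_ball_complex)
    then show ?thesis
      unfolding dint_def by (subst nn_integral_add, measurable, subst nn_integral_add, measurable)
        (simp add: nn_integral_cmult del: indicator_UNIV)
  qed
  also have "\<dots> \<le> ennreal (C1 powr q) * dint q n (G_set u \<psi> n \<epsilon>) f +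
      (ennreal (\<eta> powr q) * (ennreal K * fint q f) + ennreal (C1 powr q) * (ennreal K * fint q f * ennreal (pi * s\<^sup>2)))"
    by (intro add_left_mono add_right_mono mult_left_mono K) auto
  also have "ennreal (\<eta> powr q) * (ennreal K * fint q f) + ennreal (C1 powr q) * (ennreal K * fint q f * ennreal (pi * s\<^sup>2)) =
      ennreal (\<eta> powr q * K + C1 powr q * (pi * s\<^sup>2) * K) * fint q f"
    using K(1) by (simp add: ennreal_mult distrib_left distrib_right mult_ac)
  finally show ?thesis unfolding fint_wcd_op[OF f] \<eta>_def .
qed

lemma bounded_below_imp_sampling_finite:
  assumes q: "q \<ge> 1" and c: "c > 0" "\<And>f. f \<in> M \<Longrightarrow> ennreal c * fint q f \<le> fint q (T f)"
    and M: "\<And>f. f \<in> M \<Longrightarrow> f holomorphic_on UNIV" "\<And>f. f \<in> M \<Longrightarrow> fint q f < \<infinity>"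
  shows "\<exists>\<epsilon>>0. \<exists>\<delta>>0. \<forall>f\<in>M. ennreal \<delta> * fint q f \<le> dint q n (G_set u \<psi> n \<epsilon>) f"
proof -
  obtain C1 where C1: "C1 > 0" "\<And>z. L1_fun u \<psi> n z \<le> C1" using L1_bounded by blast
  obtain K where K: "K > 0" "\<And>f w. f holomorphic_on UNIV \<Longrightarrow> ennreal (wder n f w powr q) \<le> ennreal K * fint q f"
    "\<And>f. f holomorphic_on UNIV \<Longrightarrow> dint q n UNIV f \<le> ennreal K * fint q f"
    using wder_powr_le_fint[OF q, of n] by metis
  \<comment> \<open>Each of the two error terms is given the size m by solving for \<open>s\<close>
    and \<open>\<epsilon>\<close>. Against 4 m on the left this leaves 2 m, the numerator of
    \<open>\<delta>\<close>.\<close>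
  define m where "m = (norm a)\<^sup>2 * c / 4"
  have m: "m > 0" using a c by (simp add: m_def)
  define s where "s = sqrt (m / (C1 powr q * pi * K))"
  have s: "s > 0" "C1 powr q * (pi * s\<^sup>2) * K = m" using m C1 K by (auto simp: s_def)
  define \<epsilon> where "\<epsilon> = (m / K) powr (1 / q) / (1 + 1 / s) ^ n"
  have s1: "(1 + 1 / s) ^ n > 0" using s by (simp add: add_pos_pos)
  have \<epsilon>: "\<epsilon> > 0" using m K s1 by (simp add: \<epsilon>_def)
  have "x * (y / x) = y" if "x > 0" for x y :: real using that by simp
  then have "(1 + 1 / s) ^ n * \<epsilon> = (m / K) powr (1 / q)" unfolding \<epsilon>_def using s1 by blast
  then have \<epsilon>q: "((1 + 1 / s) ^ n * \<epsilon>) powr q * K = m" using m K q by (simp add: powr_powr)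
  define \<delta> where "\<delta> = 2 * m / C1 powr q"
  have \<delta>: "\<delta> > 0" using m C1 by (simp add: \<delta>_def)
  have "ennreal \<delta> * fint q f \<le> dint q n (G_set u \<psi> n \<epsilon>) f" if f: "f \<in> M" for f
  proof (cases "dint q n (G_set u \<psi> n \<epsilon>) f")
    case (real d)
    \<comment> \<open>Finiteness of the norm is what allows the error term to be subtracted from
      both sides.\<close>
    obtain I where I: "fint q f = ennreal I" "I \<ge> 0" using M(2)[OF f] by (cases "fint q f") auto
    have "ennreal (4 * m) * fint q f = ennreal ((norm a)\<^sup>2) * (ennreal c * fint q f)"
      using c(1) by (simp add: m_def ennreal_mult mult.assoc)
    also have "\<dots> \<le> ennreal ((norm a)\<^sup>2) * fint q (T f)" by (intro mult_left_mono c f) auto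
    also have "\<dots> \<le> ennreal (C1 powr q) * dint q n (G_set u \<psi> n \<epsilon>) f + ennreal (m + m) * fint q f"
      using fint_le_dint_add[OF M(1)[OF f] \<epsilon> q s(1) C1 K(1) K(2)[OF M(1)[OF f]] K(3)[OF M(1)[OF f]]]
      unfolding \<epsilon>q s(2) .
    finally have "4 * m * I \<le> C1 powr q * d + 2 * m * I"
      unfolding I(1) real(2) using m I(2) real(1) C1
      by (simp flip: ennreal_mult ennreal_plus)
    then have "\<delta> * I \<le> d" using C1 by (simp add: \<delta>_def field_simps)
    then show ?thesis unfolding I(1) real(2) using \<delta> I(2) by (simp add: ennreal_leI flip: ennreal_mult)
  qed simp
  then show ?thesis using \<epsilon> \<delta> by blast
qed

lemma bounded_below_iff_sampling:
  assumes p: "1 \<le> p"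
  shows "(\<exists>c>0. \<forall>f\<in>fock_space0 p n. ennreal c * fock_enorm p f \<le> fock_enorm p (T f)) \<longleftrightarrow>
    (\<exists>\<epsilon>>0. sampling_set p n (G_set u \<psi> n \<epsilon>) (fock_space0 p n))"
proof (cases "p = \<infinity>")
  case True
  then show ?thesis
    using bounded_below_imp_sampling_infinity[OF True] sampling_imp_bounded_below_infinity[OF True] by metis
next
  case False
  define q where "q = enn2real p"
  have q: "q \<ge> 1" using enn2real_exponent_ge_1[OF p False] by (simp add: q_def)
  then have q0: "q > 0" by simp
  \<comment> \<open>The norm carries this factor and the sampling integral does not: it cancels when
    two norms are compared and is absorbed into the constant in the sampling inequality.\<close>
  define \<kappa> where "\<kappa> = q / (2 * pi)"
  have \<kappa>: "\<kappa> > 0" using q by (simp add: \<kappa>_def)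
  have en: "fock_enorm p f = epowr (ennreal \<kappa> * fint q f) (1 / q)" for f
    using fock_enorm_finite[OF False] by (simp add: q_def \<kappa>_def)
  have samp: "sampling_enorm p n S f = epowr (dint q n S f) (1 / q)" for S f
    using sampling_enorm_finite[OF False] by (simp add: q_def)
  have hol: "f holomorphic_on UNIV" if "f \<in> fock_space0 p n" for f
    using that fock_space0D fock_spaceD by blast
  have fin: "fint q f < \<infinity>" if "f \<in> fock_space0 p n" for f
  proof -
    have "fock_enorm p f \<le> ennreal (fock_norm p f)" using ennreal_fock_norm[OF fock_space0D[OF that]] by simp
    then have "fint q f \<le> ennreal (2 * pi / q * fock_norm p f powr q)"
      using fock_enorm_le_iff[OF p False] by (simp add: q_def)
    then show ?thesis by (rule le_less_trans) simp
  qed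
  have scale: "ennreal c * (ennreal \<kappa> * x) = ennreal (c * \<kappa>) * x" if "c > 0" for c x
    using that \<kappa> by (simp add: ennreal_mult mult.assoc)
  have cancel: "x \<le> y" if "ennreal t * x \<le> ennreal t * y" "t > 0" for t x y
  proof -
    have "ennreal (1 / t) * (ennreal t * v) = v" for v
      using that(2) by (subst mult.assoc[symmetric], subst ennreal_mult[symmetric]) auto
    then show ?thesis using mult_left_mono[OF that(1), of "ennreal (1 / t)"] by simp
  qed
  have 1: "(\<exists>c>0. \<forall>f\<in>fock_space0 p n. ennreal c * fock_enorm p f \<le> fock_enorm p (T f)) \<longleftrightarrow>
      (\<exists>c>0. \<forall>f\<in>fock_space0 p n. ennreal c * fint q f \<le> fint q (T f))"
  proof -
    have "ennreal c * (ennreal \<kappa> * x) \<le> ennreal \<kappa> * y \<longleftrightarrow> ennreal c * x \<le> y" for c x y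
    proof
      show "ennreal c * x \<le> y" if "ennreal c * (ennreal \<kappa> * x) \<le> ennreal \<kappa> * y"
        by (rule cancel[OF _ \<kappa>]) (use that in \<open>simp only: mult.left_commute\<close>)
      show "ennreal c * (ennreal \<kappa> * x) \<le> ennreal \<kappa> * y" if "ennreal c * x \<le> y"
        using mult_left_mono[OF that, of "ennreal \<kappa>"] by (simp add: mult.left_commute)
    qed
    then show ?thesis unfolding en epowr_bounded_below_iff[OF q0] by simp
  qed
  have 2: "sampling_set p n S (fock_space0 p n) \<longleftrightarrow>
      (\<exists>c>0. \<forall>f\<in>fock_space0 p n. ennreal c * fint q f \<le> dint q n S f)" for S
    unfolding sampling_set_def samp en epowr_bounded_below_iff[OF q0]
  proof
    assume "\<exists>c>0. \<forall>f\<in>fock_space0 p n. ennreal c * (ennreal \<kappa> * fint q f) \<le> dint q n S f"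
    then obtain c where c: "c > 0" "\<forall>f\<in>fock_space0 p n. ennreal c * (ennreal \<kappa> * fint q f) \<le> dint q n S f" by blast
    then have "\<forall>f\<in>fock_space0 p n. ennreal (c * \<kappa>) * fint q f \<le> dint q n S f" by (simp add: scale)
    then show "\<exists>c>0. \<forall>f\<in>fock_space0 p n. ennreal c * fint q f \<le> dint q n S f"
      using c(1) \<kappa> by (intro exI[of _ "c * \<kappa>"]) simp
  next
    assume "\<exists>c>0. \<forall>f\<in>fock_space0 p n. ennreal c * fint q f \<le> dint q n S f"
    then obtain c where c: "c > 0" "\<forall>f\<in>fock_space0 p n. ennreal c * fint q f \<le> dint q n S f" by blast
    then have "\<forall>f\<in>fock_space0 p n. ennreal (c / \<kappa>) * (ennreal \<kappa> * fint q f) \<le> dint q n S f"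
      using \<kappa> by (subst scale) auto
    then show "\<exists>c>0. \<forall>f\<in>fock_space0 p n. ennreal c * (ennreal \<kappa> * fint q f) \<le> dint q n S f"
      using c(1) \<kappa> by (intro exI[of _ "c / \<kappa>"]) simp
  qed
  show ?thesis unfolding 1 2
  proof
    assume "\<exists>c>0. \<forall>f\<in>fock_space0 p n. ennreal c * fint q f \<le> fint q (T f)"
    then show "\<exists>\<epsilon>>0. \<exists>c>0. \<forall>f\<in>fock_space0 p n. ennreal c * fint q f \<le> dint q n (G_set u \<psi> n \<epsilon>) f"
      using bounded_below_imp_sampling_finite[OF q _ _ hol fin] by metis
  next
    assume "\<exists>\<epsilon>>0. \<exists>c>0. \<forall>f\<in>fock_space0 p n. ennreal c * fint q f \<le> dint q n (G_set u \<psi> n \<epsilon>) f"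
    then obtain \<epsilon> c where c: "\<epsilon> > 0" "c > 0" "\<And>f. f \<in> fock_space0 p n \<Longrightarrow> ennreal c * fint q f \<le> dint q n (G_set u \<psi> n \<epsilon>) f"
      by blast
    define t where "t = (norm a)\<^sup>2"
    have t: "t > 0" using a by (simp add: t_def)
    have "ennreal (\<epsilon> powr q * c / t) * fint q f \<le> fint q (T f)" if f: "f \<in> fock_space0 p n" for f
    proof (rule cancel[OF _ t])
      have "ennreal t * (ennreal (\<epsilon> powr q * c / t) * fint q f) = ennreal (\<epsilon> powr q) * (ennreal c * fint q f)"
        using t c(1,2)
        by (subst (1 2) mult.assoc[symmetric], subst (1 2) ennreal_mult[symmetric]) auto
      also have "\<dots> \<le> ennreal (\<epsilon> powr q) * dint q n (G_set u \<psi> n \<epsilon>) f" by (intro mult_left_mono c(3) f) auto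
      also have "\<dots> \<le> ennreal t * fint q (T f)"
        unfolding t_def by (rule sampling_imp_fint_le[OF hol[OF f] c(1) q])
      finally show "ennreal t * (ennreal (\<epsilon> powr q * c / t) * fint q f) \<le> ennreal t * fint q (T f)" .
    qed
    then show "\<exists>c>0. \<forall>f\<in>fock_space0 p n. ennreal c * fint q f \<le> fint q (T f)"
      using c(1,2) t by (intro exI[of _ "\<epsilon> powr q * c / t"]) simp
  qed
qed

end

text \<open>The case u = 0 is excluded for a reason: the range would be {0}, which is closed, while
  every G^\<epsilon> would be empty and z^n, a nonzero element of the subspace, would violate the
  sampling inequality.\<close>

theorem theorem1p10:
  fixes u \<psi> :: "complex \<Rightarrow> complex" and p :: ennreal and n :: nat
  assumes "u holomorphic_on UNIV" and "\<psi> holomorphic_on UNIV"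
    and "\<exists>z. u z \<noteq> 0"
    and "\<not> \<psi> constant_on UNIV"
    and "1 \<le> p"
    and "bounded_on_fock p (wcd_op u \<psi> n)"
  shows "closed_range_on_fock p (wcd_op u \<psi> n) \<longleftrightarrow>
    (\<exists>\<epsilon>>0. sampling_set p n (G_set u \<psi> n \<epsilon>) (fock_space0 p n))"
proof -
  obtain C where C: "\<And>z. L_fun u \<psi> n z \<le> C"
    using L_fun_bounded[OF assms(5,6)] by blast
  obtain z0 where z0: "u z0 \<noteq> 0" using assms(3) by blast
  obtain a b where ab: "a \<noteq> 0" "\<psi> = (\<lambda>z. b + a * z)"
    using symbol_affine[OF assms(1) z0 assms(2,4) C] by blast
  interpret affine_symbol u \<psi> n a b C
    by unfold_locales (use assms(1) ab C in auto)
  have "closed_range_on_fock p (wcd_op u \<psi> n) \<longleftrightarrow>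
      (\<exists>c>0. \<forall>f\<in>fock_space0 p n. c * fock_norm p f \<le> fock_norm p (wcd_op u \<psi> n f))"
    by (rule closed_range_iff_bounded_below[OF assms(1,3,2,4,5,6)])
  also have "\<dots> \<longleftrightarrow>
      (\<exists>c>0. \<forall>f\<in>fock_space0 p n. ennreal c * fock_enorm p f \<le> fock_enorm p (wcd_op u \<psi> n f))"
    by (rule bounded_below_enorm_iff[OF assms(6)]) (auto dest: fock_space0D)
  also have "\<dots> \<longleftrightarrow> (\<exists>\<epsilon>>0. sampling_set p n (G_set u \<psi> n \<epsilon>) (fock_space0 p n))"
    by (rule bounded_below_iff_sampling[OF assms(5)])
  finally show ?thesis .
qed

end
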